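(* There is an algorithm that solves the Constrained $k$-near Chain Addition problem in time $O(n^3 k^{2k+2})$, where $n=|S|+|Q|$.
   Context: The input is a bipartite graph $G=(S\cup Q,E)$ (students $S$, questions $Q$; $sq\in E$ means student $s$ answered question $q$ correctly), a bijection $\alpha:S\to\{1,\dots,|S|\}$ (initial student ordering), a positive integer $k$, and a fixed bijection $\beta:Q\to\{1,\dots,|Q|\}$ (question ordering, from easiest to hardest). For a vertex $x$, $N(x)$ denotes its neighborhood. An ordering (bijection) $\pi:S\to\{1,\dots,|S|\}$ is nested if $\pi(s_1)\ge \pi(s_2)$ implies $N(s_1)\supseteq N(s_2)$. The ordering $\beta$ satisfies the interval property if for every $s\in S$, $N(s)=\{\beta^{-1}(1),\dots,\beta^{-1}(j)\}$ for some $j\in\{0,\dots,|Q|\}$. The Constrained $k$-near Chain Addition problem asks for a minimum-size set of edges (student–question pairs) to add to $G$ (no deletions allowed) such that in the resulting graph there is a nested student ordering $\pi$ with $\pi(s)\in[\alpha(s)-k,\alpha(s)+k]$ for all $s\in S$, and the given question ordering $\beta$ satisfies the interval property. *)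

theory Defs
  imports Main
begin

section \<open>Constrained k-near Chain Addition\<close>

text \<open>
  A bipartite graph is given by its two sides \<open>S\<close> (students) and \<open>Q\<close> (questions) and a set of
  pairs \<open>E \<subseteq> S \<times> Q\<close>. The sides are separate sorts, so the graph has \<open>card S + card Q\<close> vertices.
\<close>

definition nbh :: "('s \<times> 'q) set \<Rightarrow> 's \<Rightarrow> 'q set" where
  "nbh E s = {q. (s, q) \<in> E}"

definition ordering :: "'a set \<Rightarrow> ('a \<Rightarrow> nat) \<Rightarrow> bool" where
  "ordering X \<pi> \<longleftrightarrow> bij_betw \<pi> X {1..card X}"

definition nested :: "'s set \<Rightarrow> ('s \<times> 'q) set \<Rightarrow> ('s \<Rightarrow> nat) \<Rightarrow> bool" where
  "nested S E \<pi> \<longleftrightarrow> (\<forall>s\<^sub>1\<in>S. \<forall>s\<^sub>2\<in>S. \<pi> s\<^sub>1 \<ge> \<pi> s\<^sub>2 \<longrightarrow> nbh E s\<^sub>1 \<supseteq> nbh E s\<^sub>2)"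

definition interval_property :: "'s set \<Rightarrow> 'q set \<Rightarrow> ('s \<times> 'q) set \<Rightarrow> ('q \<Rightarrow> nat) \<Rightarrow> bool" where
  "interval_property S Q E \<beta> \<longleftrightarrow>
     (\<forall>s\<in>S. \<exists>j\<in>{0..card Q}. nbh E s = inv_into Q \<beta> ` {1..j})"

definition near :: "'s set \<Rightarrow> nat \<Rightarrow> ('s \<Rightarrow> nat) \<Rightarrow> ('s \<Rightarrow> nat) \<Rightarrow> bool" where
  "near S k \<alpha> \<pi> \<longleftrightarrow>
     (\<forall>s\<in>S. int (\<pi> s) \<in> {int (\<alpha> s) - int k .. int (\<alpha> s) + int k})"

definition cnca_instance ::
  "'s set \<Rightarrow> 'q set \<Rightarrow> ('s \<times> 'q) set \<Rightarrow> ('s \<Rightarrow> nat) \<Rightarrow> ('q \<Rightarrow> nat) \<Rightarrow> nat \<Rightarrow> bool" where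
  "cnca_instance S Q E \<alpha> \<beta> k \<longleftrightarrow>
     finite S \<and> finite Q \<and> E \<subseteq> S \<times> Q \<and> ordering S \<alpha> \<and> ordering Q \<beta> \<and> k > 0"

definition cnca_feasible ::
  "'s set \<Rightarrow> 'q set \<Rightarrow> ('s \<times> 'q) set \<Rightarrow> ('s \<Rightarrow> nat) \<Rightarrow> ('q \<Rightarrow> nat) \<Rightarrow> nat \<Rightarrow> ('s \<times> 'q) set \<Rightarrow> bool"
where
  "cnca_feasible S Q E \<alpha> \<beta> k F \<longleftrightarrow>
     F \<subseteq> S \<times> Q - E \<and>
     (\<exists>\<pi>. ordering S \<pi> \<and> nested S (E \<union> F) \<pi> \<and> near S k \<alpha> \<pi>) \<and>
     interval_property S Q (E \<union> F) \<beta>"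

definition cnca_optimal ::
  "'s set \<Rightarrow> 'q set \<Rightarrow> ('s \<times> 'q) set \<Rightarrow> ('s \<Rightarrow> nat) \<Rightarrow> ('q \<Rightarrow> nat) \<Rightarrow> nat \<Rightarrow> ('s \<times> 'q) set \<Rightarrow> bool"
where
  "cnca_optimal S Q E \<alpha> \<beta> k F \<longleftrightarrow>
     cnca_feasible S Q E \<alpha> \<beta> k F \<and>
     (\<forall>F'. cnca_feasible S Q E \<alpha> \<beta> k F' \<longrightarrow> card F \<le> card F')"


section \<open>Unit-cost RAM programs\<close>

text \<open>
  Structured programs for the unit-cost random access machine with addition and subtraction:
  finitely many registers and finitely many unboundedly long arrays (those named in the program)
  hold natural numbers. Every constant, register access, array access, arithmetic operation,
  comparison, connective, assignment and branch costs one time unit. Multiplication is not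
  primitive. Subtraction is truncated at 0.
\<close>

type_synonym name = string

record state =
  reg :: "name \<Rightarrow> nat"
  arr :: "name \<Rightarrow> nat \<Rightarrow> nat"

datatype aexp =
    Const nat
  | Reg name
  | Arr name aexp
  | Plus aexp aexp
  | Minus aexp aexp

datatype bexp =
    Less aexp aexp
  | Equal aexp aexp
  | Neg bexp
  | Conj bexp bexp

datatype com =
    Skip
  | Assign name aexp
  | Store name aexp aexp
  | Seq com com
  | Cond bexp com com
  | While bexp com

fun aval :: "aexp \<Rightarrow> state \<Rightarrow> nat" where
  "aval (Const n) \<sigma> = n"
| "aval (Reg x) \<sigma> = reg \<sigma> x"
| "aval (Arr a e) \<sigma> = arr \<sigma> a (aval e \<sigma>)"
| "aval (Plus e\<^sub>1 e\<^sub>2) \<sigma> = aval e\<^sub>1 \<sigma> + aval e\<^sub>2 \<sigma>"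
| "aval (Minus e\<^sub>1 e\<^sub>2) \<sigma> = aval e\<^sub>1 \<sigma> - aval e\<^sub>2 \<sigma>"

fun acost :: "aexp \<Rightarrow> nat" where
  "acost (Const n) = 1"
| "acost (Reg x) = 1"
| "acost (Arr a e) = acost e + 1"
| "acost (Plus e\<^sub>1 e\<^sub>2) = acost e\<^sub>1 + acost e\<^sub>2 + 1"
| "acost (Minus e\<^sub>1 e\<^sub>2) = acost e\<^sub>1 + acost e\<^sub>2 + 1"

fun bval :: "bexp \<Rightarrow> state \<Rightarrow> bool" where
  "bval (Less e\<^sub>1 e\<^sub>2) \<sigma> \<longleftrightarrow> aval e\<^sub>1 \<sigma> < aval e\<^sub>2 \<sigma>"
| "bval (Equal e\<^sub>1 e\<^sub>2) \<sigma> \<longleftrightarrow> aval e\<^sub>1 \<sigma> = aval e\<^sub>2 \<sigma>"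
| "bval (Neg b) \<sigma> \<longleftrightarrow> \<not> bval b \<sigma>"
| "bval (Conj b\<^sub>1 b\<^sub>2) \<sigma> \<longleftrightarrow> bval b\<^sub>1 \<sigma> \<and> bval b\<^sub>2 \<sigma>"

fun bcost :: "bexp \<Rightarrow> nat" where
  "bcost (Less e\<^sub>1 e\<^sub>2) = acost e\<^sub>1 + acost e\<^sub>2 + 1"
| "bcost (Equal e\<^sub>1 e\<^sub>2) = acost e\<^sub>1 + acost e\<^sub>2 + 1"
| "bcost (Neg b) = bcost b + 1"
| "bcost (Conj b\<^sub>1 b\<^sub>2) = bcost b\<^sub>1 + bcost b\<^sub>2 + 1"

text \<open>\<open>exec c \<sigma> t \<tau>\<close>: started in \<open>\<sigma>\<close>, the program \<open>c\<close> halts in \<open>\<tau>\<close> after exactly \<open>t\<close> time units.\<close>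

inductive exec :: "com \<Rightarrow> state \<Rightarrow> nat \<Rightarrow> state \<Rightarrow> bool" where
  Skip: "exec Skip \<sigma> 1 \<sigma>"
| Assign: "exec (Assign x e) \<sigma> (acost e + 1) (\<sigma>\<lparr>reg := (reg \<sigma>)(x := aval e \<sigma>)\<rparr>)"
| Store: "exec (Store a i e) \<sigma> (acost i + acost e + 1)
    (\<sigma>\<lparr>arr := (arr \<sigma>)(a := (arr \<sigma> a)(aval i \<sigma> := aval e \<sigma>))\<rparr>)"
| Seq: "exec c\<^sub>1 \<sigma> t\<^sub>1 \<sigma>' \<Longrightarrow> exec c\<^sub>2 \<sigma>' t\<^sub>2 \<tau> \<Longrightarrow> exec (Seq c\<^sub>1 c\<^sub>2) \<sigma> (t\<^sub>1 + t\<^sub>2) \<tau>"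
| CondTrue: "bval b \<sigma> \<Longrightarrow> exec c\<^sub>1 \<sigma> t \<tau> \<Longrightarrow> exec (Cond b c\<^sub>1 c\<^sub>2) \<sigma> (bcost b + 1 + t) \<tau>"
| CondFalse: "\<not> bval b \<sigma> \<Longrightarrow> exec c\<^sub>2 \<sigma> t \<tau> \<Longrightarrow> exec (Cond b c\<^sub>1 c\<^sub>2) \<sigma> (bcost b + 1 + t) \<tau>"
| WhileFalse: "\<not> bval b \<sigma> \<Longrightarrow> exec (While b c) \<sigma> (bcost b + 1) \<sigma>"
| WhileTrue: "bval b \<sigma> \<Longrightarrow> exec c \<sigma> t\<^sub>1 \<sigma>' \<Longrightarrow> exec (While b c) \<sigma>' t\<^sub>2 \<tau> \<Longrightarrow>
    exec (While b c) \<sigma> (bcost b + 1 + t\<^sub>1 + t\<^sub>2) \<tau>"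

inductive_cases SkipE: "exec Skip \<sigma> t \<tau>"
inductive_cases AssignE: "exec (Assign x e) \<sigma> t \<tau>"
inductive_cases StoreE: "exec (Store a i e) \<sigma> t \<tau>"
inductive_cases SeqE: "exec (Seq c\<^sub>1 c\<^sub>2) \<sigma> t \<tau>"
inductive_cases CondE: "exec (Cond b c\<^sub>1 c\<^sub>2) \<sigma> t \<tau>"
inductive_cases WhileE: "exec (While b c) \<sigma> t \<tau>"

lemma exec_deterministic:
  "exec c \<sigma> t \<tau> \<Longrightarrow> exec c \<sigma> t' \<tau>' \<Longrightarrow> t' = t \<and> \<tau>' = \<tau>"
proof (induction arbitrary: t' \<tau>' rule: exec.induct)
  case (Skip \<sigma>)
  then show ?case by (rule SkipE) simp
next
  case (Assign x e \<sigma>)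
  then show ?case by (rule AssignE) simp
next
  case (Store a i e \<sigma>)
  then show ?case by (rule StoreE) simp
next
  case (Seq c\<^sub>1 \<sigma> t\<^sub>1 \<sigma>' c\<^sub>2 t\<^sub>2 \<tau>)
  from Seq.prems obtain u\<^sub>1 \<rho> u\<^sub>2
    where "exec c\<^sub>1 \<sigma> u\<^sub>1 \<rho>" "exec c\<^sub>2 \<rho> u\<^sub>2 \<tau>'" "t' = u\<^sub>1 + u\<^sub>2"
    by (rule SeqE)
  with Seq.IH show ?case by metis
next
  case (CondTrue b \<sigma> c\<^sub>1 t \<tau> c\<^sub>2)
  from CondTrue.prems CondTrue.hyps obtain u where "exec c\<^sub>1 \<sigma> u \<tau>'" "t' = bcost b + 1 + u"
    by (auto elim: CondE)
  with CondTrue.IH show ?case by metis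
next
  case (CondFalse b \<sigma> c\<^sub>2 t \<tau> c\<^sub>1)
  from CondFalse.prems CondFalse.hyps obtain u where "exec c\<^sub>2 \<sigma> u \<tau>'" "t' = bcost b + 1 + u"
    by (auto elim: CondE)
  with CondFalse.IH show ?case by metis
next
  case (WhileFalse b \<sigma> c)
  from WhileFalse.prems show ?case
    by (rule WhileE) (use WhileFalse.hyps in simp_all)
next
  case (WhileTrue b \<sigma> c t\<^sub>1 \<sigma>' t\<^sub>2 \<tau>)
  from WhileTrue.prems obtain u\<^sub>1 \<rho> u\<^sub>2
    where "exec c \<sigma> u\<^sub>1 \<rho>" "exec (While b c) \<rho> u\<^sub>2 \<tau>'" "t' = bcost b + 1 + u\<^sub>1 + u\<^sub>2"
    by (rule WhileE) (use WhileTrue.hyps in simp_all)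
  with WhileTrue.IH show ?case by metis
qed


section \<open>Input and output conventions\<close>

definition input_state :: "nat list \<Rightarrow> state" where
  "input_state xs =
     \<lparr>reg = (\<lambda>_. 0),
      arr = (\<lambda>a i. if a = ''in'' \<and> i < length xs then xs ! i else 0)\<rparr>"

text \<open>
  The lists \<open>ss\<close> and \<open>qs\<close> number the students and the questions from 0. The input consists of the
  two cardinalities, \<open>k\<close>, the tables of \<open>\<alpha>\<close> and \<open>\<beta>\<close>, and the adjacency matrix row by row.
\<close>

definition encode ::
  "'s list \<Rightarrow> 'q list \<Rightarrow> ('s \<times> 'q) set \<Rightarrow> ('s \<Rightarrow> nat) \<Rightarrow> ('q \<Rightarrow> nat) \<Rightarrow> nat \<Rightarrow> nat list" where
  "encode ss qs E \<alpha> \<beta> k =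
     [length ss, length qs, k] @ map \<alpha> ss @ map \<beta> qs @
     concat (map (\<lambda>s. map (\<lambda>q. if (s, q) \<in> E then 1 else 0) qs) ss)"

text \<open>
  The array \<open>out\<close> holds the edge set \<open>F\<close> as the number of edges followed by the edges, each
  listed once as the number of its student and the number of its question.
\<close>

definition outputs_edges :: "state \<Rightarrow> 's list \<Rightarrow> 'q list \<Rightarrow> ('s \<times> 'q) set \<Rightarrow> bool" where
  "outputs_edges \<sigma> ss qs F \<longleftrightarrow>
     (\<exists>ps :: (nat \<times> nat) list.
        distinct ps \<and> set ps \<subseteq> {..<length ss} \<times> {..<length qs} \<and>
        arr \<sigma> ''out'' 0 = length ps \<and>
        (\<forall>l<length ps. (arr \<sigma> ''out'' (2 * l + 1), arr \<sigma> ''out'' (2 * l + 2)) = ps ! l) \<and>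
        F = (\<lambda>(i, j). (ss ! i, qs ! j)) ` set ps)"

end

theory Submission
  imports Defs
begin

text \<open>
  Name each student by its value under \<open>\<alpha>\<close> and let \<open>w x\<close> be the largest \<open>\<beta>\<close>-value of a question
  answered by student \<open>x\<close>. For a fixed ordering of the students the cheapest solution gives the
  student at position \<open>p\<close> the first \<open>J p\<close> questions, \<open>J p\<close> being the maximum of \<open>w\<close> over the
  positions up to \<open>p\<close>. A greedy algorithm minimises all these prefix maxima simultaneously: fill the
  positions in increasing order, each with a student of least \<open>w\<close> among those that may come so
  early and whose choice leaves the remaining students schedulable. If the greedy algorithm first
  needs a weight \<open>\<ge> t\<close> at position \<open>p\<close>, then either every student of smaller weight allowed by
  position \<open>p\<close> is already placed, or some students of weight \<open>\<ge> t\<close> would not fit between \<open>p + 1\<close>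
  and their common deadline; so every admissible ordering has weight \<open>\<ge> t\<close> at or before \<open>p\<close>.
  Feasibility of the rest can be tested by one scan, so the running time is quadratic, with no
  exponential dependence on \<open>k\<close>.
\<close>

subsection \<open>The greedy ordering\<close>

definition rest :: "nat \<Rightarrow> (nat \<Rightarrow> nat) \<Rightarrow> nat \<Rightarrow> nat set" where
  "rest N g p = {1..N} - g ` {1..<p}"

text \<open>
  If the students in \<open>U\<close> fill the positions from \<open>p\<close> on in increasing order, then a tight student
  sits exactly at its last admissible position, so no student after it may be drawn forward to \<open>p\<close>.
\<close>

definition tight :: "nat \<Rightarrow> nat set \<Rightarrow> nat \<Rightarrow> nat \<Rightarrow> bool" where
  "tight k U p z \<longleftrightarrow> p + card {v\<in>U. v < z} = z + k"

text \<open>Placing \<open>y\<close> at \<open>p\<close> moves every smaller remaining student one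
  position back in the increasing completion, hence the condition on \<open>tight\<close>. The bound
  \<open>y \<le> p + k\<close> says that \<open>p\<close> is not too early for \<open>y\<close>;
  that \<open>p\<close> is not too late for \<open>y\<close> comes from
  \<open>greedy_slack\<close>.\<close>

definition cand :: "nat \<Rightarrow> nat set \<Rightarrow> nat \<Rightarrow> nat \<Rightarrow> bool" where
  "cand k U p y \<longleftrightarrow> y \<in> U \<and> y \<le> p + k \<and> (\<forall>z\<in>U. z < y \<longrightarrow> \<not> tight k U p z)"

text \<open>A relation rather than a function: ties between candidates of least weight stay open, so
  any tie-breaking by the program is covered. Here \<open>g\<close> maps positions to
  students.\<close>

definition greedy :: "nat \<Rightarrow> nat \<Rightarrow> (nat \<Rightarrow> nat) \<Rightarrow> (nat \<Rightarrow> nat) \<Rightarrow> nat \<Rightarrow> bool" where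
  "greedy N k w g n \<longleftrightarrow>
     (\<forall>p\<in>{1..n}. cand k (rest N g p) p (g p) \<and>
        (\<forall>y. cand k (rest N g p) p y \<longrightarrow> w (g p) \<le> w y))"

lemma finite_rest [simp]: "finite (rest N g p)"
  by (simp add: rest_def)

lemma rest_Suc: "1 \<le> p \<Longrightarrow> rest N g (Suc p) = rest N g p - {g p}"
  by (auto simp: rest_def less_Suc_eq)

lemma rest_cong: "(\<And>q. 1 \<le> q \<Longrightarrow> q < p \<Longrightarrow> g q = g' q) \<Longrightarrow> rest N g p = rest N g' p"
proof -
  assume "\<And>q. 1 \<le> q \<Longrightarrow> q < p \<Longrightarrow> g q = g' q"
  then have "g ` {1..<p} = g' ` {1..<p}"
    by (intro image_cong) auto
  then show ?thesis by (simp add: rest_def)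
qed

lemma greedyD:
  assumes "greedy N k w g n" "1 \<le> p" "p \<le> n"
  shows "cand k (rest N g p) p (g p)"
    and "cand k (rest N g p) p y \<Longrightarrow> w (g p) \<le> w y"
    and "g p \<in> rest N g p"
  using assms by (auto simp: greedy_def cand_def)

lemma greedy_Suc:
  assumes "greedy N k w g n" "cand k (rest N g (Suc n)) (Suc n) b"
    and "\<And>y. cand k (rest N g (Suc n)) (Suc n) y \<Longrightarrow> w b \<le> w y"
  shows "greedy N k w (g(Suc n := b)) (Suc n)"
proof -
  have r: "rest N (g(Suc n := b)) p = rest N g p" if "p \<le> Suc n" for p
    using that by (intro rest_cong) auto
  show ?thesis
    using assms unfolding greedy_def by (auto simp: r le_Suc_eq)
qed

section \<open>The greedy ordering is an admissible bijection\<close>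

lemma greedy_inj:
  assumes "greedy N k w g n"
  shows "inj_on g {1..n}"
proof (rule linorder_inj_onI)
  fix p q assume "p < q" "p \<in> {1..n}" "q \<in> {1..n}"
  then have "g q \<in> rest N g q" "g p \<in> g ` {1..<q}"
    using greedyD(3)[OF assms, of q] by auto
  then show "g p \<noteq> g q" by (auto simp: rest_def)
qed auto

lemma greedy_bij:
  assumes "greedy N k w g N"
  shows "bij_betw g {1..N} {1..N}"
proof -
  have "g ` {1..N} \<subseteq> {1..N}"
    using greedyD(3)[OF assms] by (auto simp: rest_def)
  then have "g ` {1..N} = {1..N}"
    using greedy_inj[OF assms] by (intro endo_inj_surj) auto
  then show ?thesis using greedy_inj[OF assms] by (simp add: bij_betw_def)
qed

text \<open>Invariant: in the increasing completion from \<open>p\<close> on, \<open>u\<close> would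
  stand at the position on the left, and \<open>u + k\<close> is its deadline. A choice below
  \<open>u\<close> leaves that position unchanged; a choice above \<open>u\<close> moves it back by
  one, which is affordable because a candidate has no tight student below it.\<close>

lemma greedy_slack:
  assumes "greedy N k w g n" "1 \<le> p" "p \<le> Suc n" "u \<in> rest N g p"
  shows "p + card {v \<in> rest N g p. v < u} \<le> u + k"
  using assms(2-4)
proof (induction p arbitrary: u rule: dec_induct)
  case base
  have "{v \<in> rest N g 1. v < u} \<subseteq> {1..<u}"
    by (auto simp: rest_def)
  from card_mono[OF _ this] base show ?case by (auto simp: rest_def)
next
  case (step p)
  let ?U = "rest N g p"
  have p: "1 \<le> p" "p \<le> n" using step by auto
  have U: "rest N g (Suc p) = ?U - {g p}" using p by (simp add: rest_Suc)
  have u: "u \<in> ?U" "u \<noteq> g p" using step.prems U by auto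
  have IH: "p + card {v \<in> ?U. v < u} \<le> u + k"
    using step.IH[OF _ u(1)] p by simp
  have gp: "g p \<in> ?U" using greedyD(3)[OF assms(1) p] .
  show ?case
  proof (cases "g p < u")
    case True
    have "{v \<in> ?U. v < u} = insert (g p) {v \<in> rest N g (Suc p). v < u}"
      using True gp by (auto simp: U)
    then have "card {v \<in> ?U. v < u} = Suc (card {v \<in> rest N g (Suc p). v < u})"
      by (simp add: U)
    then show ?thesis using IH by simp
  next
    case False
    then have "u < g p" using u by simp
    then have "\<not> tight k ?U p u"
      using greedyD(1)[OF assms(1) p] u by (simp add: cand_def)
    then have "Suc p + card {v \<in> ?U. v < u} \<le> u + k"
      using IH by (simp add: tight_def)
    moreover have "{v \<in> rest N g (Suc p). v < u} = {v \<in> ?U. v < u}"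
      using False by (auto simp: U)
    ultimately show ?thesis by simp
  qed
qed

lemma greedy_near:
  assumes "greedy N k w g n" "1 \<le> p" "p \<le> n"
  shows "g p \<le> p + k" "p \<le> g p + k"
  using greedyD(1)[OF assms] greedy_slack[OF assms(1,2) _ greedyD(3)[OF assms]] assms
  by (auto simp: cand_def)

text \<open>The least remaining student works: all smaller ones are among the at most
  \<open>p - 1\<close> placed students, so its label is at most \<open>p\<close>, and no remaining
  student below it could be tight.\<close>

lemma cand_exists:
  assumes "1 \<le> p" "p \<le> N"
  shows "\<exists>y. cand k (rest N g p) p y"
proof -
  let ?U = "rest N g p"
  have "card (g ` {1..<p}) \<le> p - 1"
    using card_image_le[of "{1..<p}" g] by simp
  then have ne: "?U \<noteq> {}"
    using card_mono[of "g ` {1..<p}" "{1..N}"] assms by (auto simp: rest_def)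
  let ?y = "Min ?U"
  have y: "?y \<in> ?U" using ne by simp
  have "{1..<?y} \<subseteq> g ` {1..<p}"
  proof
    fix v assume "v \<in> {1..<?y}"
    moreover from this have "v \<notin> ?U" using Min_le[OF finite_rest, of v N g p] by fastforce
    moreover have "?y \<le> N" using y by (simp add: rest_def)
    ultimately have "v \<notin> ?U" "v \<in> {1..N}" by auto
    then show "v \<in> g ` {1..<p}" by (auto simp: rest_def)
  qed
  from card_mono[OF _ this] \<open>card (g ` {1..<p}) \<le> p - 1\<close> assms
  have "?y \<le> p" by simp
  then have "cand k ?U p ?y"
    using y by (auto simp: cand_def dest: Min_le[OF finite_rest, THEN leD])
  then show ?thesis ..
qed

text \<open>The ordering \<open>h\<close> is an arbitrary admissible one, also read from positions
  to students. The conclusion bounds each prefix maximum of \<open>w\<close> along \<open>g\<close>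
  by the one along \<open>h\<close>; if it failed, the first \<open>p\<close> students of
  \<open>h\<close> would all be lighter than \<open>t\<close>, which two counting arguments
  refute.\<close>

lemma greedy_dominates:
  assumes g: "greedy N k w g N"
    and h: "bij_betw h {1..N} {1..N}"
    and near: "\<And>r. r \<in> {1..N} \<Longrightarrow> h r \<le> r + k \<and> r \<le> h r + k"
    and p0: "p0 \<in> {1..N}"
  shows "\<exists>r\<in>{1..p0}. w (g p0) \<le> w (h r)"
proof -
  define t where "t = w (g p0)"
  define p where "p = (LEAST p. 1 \<le> p \<and> t \<le> w (g p))"
  have p: "1 \<le> p \<and> t \<le> w (g p)"
    unfolding p_def by (rule LeastI[of _ p0]) (use p0 t_def in auto)
  have "p \<le> p0"
    unfolding p_def by (rule Least_le) (use p0 t_def in auto)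
  then have pN: "p \<le> N" using p0 by simp
  have before: "w (g q) < t" if "1 \<le> q" "q < p" for q
    using not_less_Least[of q "\<lambda>p. 1 \<le> p \<and> t \<le> w (g p)"] that by (auto simp: p_def)
  let ?U = "rest N g p"
  have cand: "t \<le> w y" if "cand k ?U p y" for y
    using greedyD(2)[OF g _ pN that] p by simp
  have "\<exists>r\<in>{1..p}. t \<le> w (h r)"
  proof (rule ccontr)
    assume "\<not> ?thesis"
    then have low: "w (h r) < t" if "r \<in> {1..p}" for r using that by (meson not_le)
    show False
    \<comment> \<open>A student of label at most \<open>p + k\<close> can be excluded from candidacy
      only by a tight student of smaller label; the split asks whether such a blocker
      remains.\<close>
    proof (cases "\<exists>z. z \<in> ?U \<and> tight k ?U p z \<and> z \<le> p + k")
      case False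
      \<comment> \<open>Without a blocker, every remaining student of label at most
        \<open>p + k\<close> is a candidate and weighs at least \<open>t\<close>. The
        \<open>p\<close> light students at the front of \<open>h\<close> would thus have to be among
        the \<open>p - 1\<close> already placed.\<close>
      have "h ` {1..p} \<subseteq> g ` {1..<p}"
      proof (rule image_subsetI)
        fix r assume r: "r \<in> {1..p}"
        then have hr: "h r \<in> {1..N}" "h r \<le> p + k"
          using h near[of r] pN by (auto simp: bij_betw_def)
        then have "h r \<in> ?U \<Longrightarrow> cand k ?U p (h r)"
          using False by (auto simp: cand_def)
        then have "h r \<notin> ?U" using cand[of "h r"] low[OF r] by linarith
        then show "h r \<in> g ` {1..<p}" using hr by (auto simp: rest_def)
      qed
      then have "card (h ` {1..p}) \<le> card (g ` {1..<p})"
        by (intro card_mono) auto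
      moreover have "card (h ` {1..p}) = p"
        using card_image[OF inj_on_subset, of h "{1..N}" "{1..p}"] h pN by (simp add: bij_betw_def)
      moreover have "card (g ` {1..<p}) \<le> p - 1"
        using card_image_le[of "{1..<p}" g] by simp
      ultimately show False using p by linarith
    next
      case True
      \<comment> \<open>By minimality every remaining student up to and including \<open>z\<close>
        is a candidate: a tight student does not block itself.\<close>
      define z where "z = (LEAST z. z \<in> ?U \<and> tight k ?U p z \<and> z \<le> p + k)"
      have z: "z \<in> ?U \<and> tight k ?U p z \<and> z \<le> p + k"
        unfolding z_def using True by (rule LeastI_ex)
      have zmin: "\<not> tight k ?U p y" if "y \<in> ?U" "y < z" for y
        using not_less_Least[of y "\<lambda>z. z \<in> ?U \<and> tight k ?U p z \<and> z \<le> p + k"] that z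
        by (auto simp: z_def[symmetric])
      let ?V = "{v \<in> ?U. v \<le> z}" and ?c = "card {v \<in> ?U. v < z}"
      have "?V = insert z {v \<in> ?U. v < z}" using z by auto
      then have cV: "card ?V = Suc ?c" by simp
      have wV: "t \<le> w v" if "v \<in> ?V" for v
        by (rule cand) (use that z zmin in \<open>auto simp: cand_def\<close>)
      \<comment> \<open>The positions where \<open>h\<close> puts the \<open>?c + 1\<close> students
        of \<open>?V\<close>. Their weight forces them after \<open>p\<close>, and their deadlines
        are at most \<open>z + k = p + ?c\<close>, which leaves room for only \<open>?c\<close> of
        them.\<close>
      define R where "R = {r \<in> {1..N}. h r \<in> ?V}"
      have "?V \<subseteq> h ` R"
      proof
        fix v assume v: "v \<in> ?V"
        then have "v \<in> {1..N}" by (auto simp: rest_def)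
        then have "v \<in> h ` {1..N}" using h by (simp add: bij_betw_def)
        then obtain r where "r \<in> {1..N}" "v = h r" ..
        then show "v \<in> h ` R" using v by (auto simp: R_def)
      qed
      then have "card ?V \<le> card (h ` R)"
        by (intro card_mono) (auto simp: R_def)
      also have "\<dots> \<le> card R" by (intro card_image_le) (auto simp: R_def)
      also have "R \<subseteq> {p<..p + ?c}"
      proof
        fix r assume r: "r \<in> R"
        then have "t \<le> w (h r)" using wV by (simp add: R_def)
        then have "p < r" using low[of r] r by (auto simp: R_def not_less[symmetric])
        moreover have "r \<le> h r + k" "h r \<le> z" using r near by (auto simp: R_def)
        moreover have "p + ?c = z + k" using z by (simp add: tight_def)
        ultimately show "r \<in> {p<..p + ?c}" by simp
      qed
      then have "card R \<le> card {p<..p + ?c}" by (intro card_mono) auto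
      finally show False using cV by simp
    qed
  qed
  then show ?thesis using \<open>p \<le> p0\<close> by (force simp: t_def)
qed

subsection \<open>Weakest preconditions with running time\<close>

text \<open>Total correctness: a halting run exists. Since \<open>exec\<close> is deterministic, it
  is the only one, and \<open>Q\<close> judges its exact time together with its final state.\<close>

definition wp :: "com \<Rightarrow> state \<Rightarrow> (nat \<Rightarrow> state \<Rightarrow> bool) \<Rightarrow> bool" where
  "wp c \<sigma> Q \<longleftrightarrow> (\<exists>t \<tau>. exec c \<sigma> t \<tau> \<and> Q t \<tau>)"

lemma wp_Skip [simp]: "wp Skip \<sigma> Q \<longleftrightarrow> Q 1 \<sigma>"
  using exec.Skip by (auto simp: wp_def elim: SkipE)

lemma wp_Assign [simp]:
  "wp (Assign x e) \<sigma> Q \<longleftrightarrow> Q (acost e + 1) (\<sigma>\<lparr>reg := (reg \<sigma>)(x := aval e \<sigma>)\<rparr>)"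
  unfolding wp_def using exec.Assign by (metis AssignE)

lemma wp_Store [simp]:
  "wp (Store a i e) \<sigma> Q \<longleftrightarrow> Q (acost i + acost e + 1)
     (\<sigma>\<lparr>arr := (arr \<sigma>)(a := (arr \<sigma> a)(aval i \<sigma> := aval e \<sigma>))\<rparr>)"
  unfolding wp_def using exec.Store by (metis StoreE)

lemma wp_Seq [simp]:
  "wp (Seq c\<^sub>1 c\<^sub>2) \<sigma> Q \<longleftrightarrow> wp c\<^sub>1 \<sigma> (\<lambda>t\<^sub>1 \<sigma>'. wp c\<^sub>2 \<sigma>' (\<lambda>t\<^sub>2. Q (t\<^sub>1 + t\<^sub>2)))"
proof
  assume "wp (Seq c\<^sub>1 c\<^sub>2) \<sigma> Q"
  then obtain t \<tau> where t: "exec (Seq c\<^sub>1 c\<^sub>2) \<sigma> t \<tau>" "Q t \<tau>" unfolding wp_def by blast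
  from t(1) show "wp c\<^sub>1 \<sigma> (\<lambda>t\<^sub>1 \<sigma>'. wp c\<^sub>2 \<sigma>' (\<lambda>t\<^sub>2. Q (t\<^sub>1 + t\<^sub>2)))"
    by (rule SeqE) (use t(2) in \<open>unfold wp_def, blast\<close>)
next
  assume "wp c\<^sub>1 \<sigma> (\<lambda>t\<^sub>1 \<sigma>'. wp c\<^sub>2 \<sigma>' (\<lambda>t\<^sub>2. Q (t\<^sub>1 + t\<^sub>2)))"
  then show "wp (Seq c\<^sub>1 c\<^sub>2) \<sigma> Q" unfolding wp_def using exec.Seq by blast
qed

lemma wp_Cond [simp]:
  "wp (Cond b c\<^sub>1 c\<^sub>2) \<sigma> Q \<longleftrightarrow>
     (if bval b \<sigma> then wp c\<^sub>1 \<sigma> (\<lambda>t. Q (bcost b + 1 + t)) else wp c\<^sub>2 \<sigma> (\<lambda>t. Q (bcost b + 1 + t)))"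
  (is "?L \<longleftrightarrow> ?R")
proof
  assume ?L
  then obtain t \<tau> where t: "exec (Cond b c\<^sub>1 c\<^sub>2) \<sigma> t \<tau>" "Q t \<tau>" unfolding wp_def by blast
  from t(1) show ?R
    by (rule CondE) (use t(2) in \<open>auto simp: wp_def\<close>)
next
  assume ?R
  show ?L
  proof (cases "bval b \<sigma>")
    case True
    with \<open>?R\<close> obtain t \<tau> where "exec c\<^sub>1 \<sigma> t \<tau>" "Q (bcost b + 1 + t) \<tau>" by (auto simp: wp_def)
    with exec.CondTrue[OF True] show ?thesis unfolding wp_def by blast
  next
    case False
    with \<open>?R\<close> obtain t \<tau> where "exec c\<^sub>2 \<sigma> t \<tau>" "Q (bcost b + 1 + t) \<tau>" by (auto simp: wp_def)
    with exec.CondFalse[OF False] show ?thesis unfolding wp_def by blast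
  qed
qed

section \<open>Registers and arrays left unchanged by a program\<close>

fun assigned :: "com \<Rightarrow> name set" where
  "assigned (Assign x e) = {x}"
| "assigned (Seq c\<^sub>1 c\<^sub>2) = assigned c\<^sub>1 \<union> assigned c\<^sub>2"
| "assigned (Cond b c\<^sub>1 c\<^sub>2) = assigned c\<^sub>1 \<union> assigned c\<^sub>2"
| "assigned (While b c) = assigned c"
| "assigned _ = {}"

fun stored :: "com \<Rightarrow> name set" where
  "stored (Store a i e) = {a}"
| "stored (Seq c\<^sub>1 c\<^sub>2) = stored c\<^sub>1 \<union> stored c\<^sub>2"
| "stored (Cond b c\<^sub>1 c\<^sub>2) = stored c\<^sub>1 \<union> stored c\<^sub>2"
| "stored (While b c) = stored c"
| "stored _ = {}"

definition frame :: "com \<Rightarrow> state \<Rightarrow> state \<Rightarrow> bool" where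
  "frame c \<sigma> \<tau> \<longleftrightarrow>
     (\<forall>x. x \<notin> assigned c \<longrightarrow> reg \<tau> x = reg \<sigma> x) \<and> (\<forall>a. a \<notin> stored c \<longrightarrow> arr \<tau> a = arr \<sigma> a)"

lemma exec_frame: "exec c \<sigma> t \<tau> \<Longrightarrow> frame c \<sigma> \<tau>"
  by (induction rule: exec.induct) (auto simp: frame_def)

text \<open>Consequence rule that also supplies the frame condition, so that invariants and
  postconditions need to mention only what the program changes.\<close>

lemma wp_frame:
  assumes "wp c \<sigma> Q" "\<And>t \<tau>. frame c \<sigma> \<tau> \<Longrightarrow> Q t \<tau> \<Longrightarrow> R t \<tau>"
  shows "wp c \<sigma> R"
  using assms exec_frame unfolding wp_def by blast

text \<open>The invariant is indexed by the number of completed iterations, of which there are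
  exactly \<open>n\<close>. Each costs one test and branch plus at most \<open>B\<close>; the final
  failing test accounts for the last \<open>bcost b + 1\<close>.\<close>

lemma wp_While:
  assumes "I 0 \<sigma>"
    and step: "\<And>i \<tau>. frame c \<sigma> \<tau> \<Longrightarrow> I i \<tau> \<Longrightarrow> i < n \<Longrightarrow>
      bval b \<tau> \<and> wp c \<tau> (\<lambda>t \<tau>'. t \<le> B \<and> I (Suc i) \<tau>')"
    and exit: "\<And>\<tau>. frame c \<sigma> \<tau> \<Longrightarrow> I n \<tau> \<Longrightarrow> \<not> bval b \<tau>"
  shows "wp (While b c) \<sigma> (\<lambda>t \<tau>. t \<le> n * (bcost b + 1 + B) + bcost b + 1 \<and> I n \<tau>)"
proof -
  \<comment> \<open>Generalised to a start after \<open>i\<close> iterations with \<open>m\<close>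
    still to come, the frame condition always referring to the state before the loop.\<close>
  have "\<exists>t \<tau>'. exec (While b c) \<tau> t \<tau>' \<and> t \<le> m * (bcost b + 1 + B) + bcost b + 1 \<and> I n \<tau>'"
    if "frame c \<sigma> \<tau>" "I i \<tau>" "i + m = n" for m i \<tau>
    using that
  proof (induction m arbitrary: i \<tau>)
    case 0
    then show ?case
      using exec.WhileFalse[OF exit, of \<tau>] by fastforce
  next
    case (Suc m)
    then obtain t \<tau>' where 1: "bval b \<tau>" "exec c \<tau> t \<tau>'" "t \<le> B" "I (Suc i) \<tau>'"
      using step[of \<tau> i] by (auto simp: wp_def)
    have "frame c \<sigma> \<tau>'"
      using exec_frame[OF 1(2)] Suc.prems(1) by (auto simp: frame_def)
    with Suc.IH[of \<tau>' "Suc i"] 1 Suc.prems obtain t' \<tau>'' where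
      2: "exec (While b c) \<tau>' t' \<tau>''" "t' \<le> m * (bcost b + 1 + B) + bcost b + 1" "I n \<tau>''"
      by auto
    from exec.WhileTrue[OF 1(1,2) 2(1)] 1 2 show ?case
      by (intro exI[of _ "bcost b + 1 + t + t'"] exI[of _ \<tau>'']) simp
  qed
  from this[of \<sigma> 0 n] assms(1) show ?thesis
    by (auto simp: wp_def frame_def)
qed

subsection \<open>Maximum with default 0\<close>

text \<open>A relation with default 0 in place of \<open>Max\<close>, whose value on the empty set
  is unspecified. The default agrees with the initial contents of registers and arrays and is the
  weight of a student without correct answers.\<close>

definition top_of :: "nat set \<Rightarrow> nat \<Rightarrow> bool" where
  "top_of X v \<longleftrightarrow> v \<in> insert 0 X \<and> (\<forall>b\<in>X. b \<le> v)"

lemma top_of_empty [simp]: "top_of {} v \<longleftrightarrow> v = 0"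
  by (auto simp: top_of_def)

lemma top_of_mono: "X \<subseteq> Y \<Longrightarrow> top_of X u \<Longrightarrow> top_of Y v \<Longrightarrow> u \<le> v"
  by (auto simp: top_of_def)

lemma top_of_insert:
  "top_of X v \<Longrightarrow> v < b \<Longrightarrow> top_of (insert b X) b"
  "top_of X v \<Longrightarrow> \<not> v < b \<Longrightarrow> top_of (insert b X) v"
  by (force simp: top_of_def)+

subsection \<open>The program\<close>

definition weights_inner :: com where
  "weights_inner =
     While (Less (Reg ''j'') (Reg ''M''))
      (Seq (Assign ''b'' (Arr ''in'' (Plus (Plus (Const 3) (Reg ''N'')) (Reg ''j''))))
      (Seq (Cond (Conj (Equal (Arr ''in'' (Reg ''o'')) (Const 1)) (Less (Arr ''w'' (Reg ''a'')) (Reg ''b'')))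
             (Store ''w'' (Reg ''a'') (Reg ''b'')) Skip)
      (Seq (Assign ''o'' (Plus (Reg ''o'') (Const 1)))
           (Assign ''j'' (Plus (Reg ''j'') (Const 1))))))"

text \<open>The matrix offset \<open>o\<close> is not reset between rows; running through the matrix
  consecutively avoids the product \<open>i * M\<close>, multiplication not being primitive. The
  array \<open>w\<close> is indexed by the label \<open>a\<close> under \<alpha>, not by the input
  number \<open>i\<close>.\<close>

definition weights :: com where
  "weights =
     Seq (Assign ''i'' (Const 0))
     (While (Less (Reg ''i'') (Reg ''N''))
      (Seq (Assign ''a'' (Arr ''in'' (Plus (Const 3) (Reg ''i''))))
      (Seq (Assign ''j'' (Const 0))
      (Seq weights_inner
           (Assign ''i'' (Plus (Reg ''i'') (Const 1)))))))"

text \<open>The part of the matrix read so far consists of \<open>i\<close> full rows and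
  \<open>j\<close> entries of the next. Rows are selected by their label \<open>x\<close>, as in the
  array \<open>w\<close>; the offsets follow the layout of \<open>encode\<close>.\<close>

definition wset :: "(nat \<Rightarrow> nat) \<Rightarrow> nat \<Rightarrow> nat \<Rightarrow> nat \<Rightarrow> nat \<Rightarrow> nat \<Rightarrow> nat set" where
  "wset A N M i j x = {A (3 + N + j') | i' j'. (i' < i \<and> j' < M \<or> i' = i \<and> j' < j) \<and>
     A (3 + i') = x \<and> A (3 + N + M + i' * M + j') = 1}"

lemma wset_Suc:
  "wset A N M i (Suc j) x = (if A (3 + i) = x \<and> A (3 + N + M + i * M + j) = 1
     then insert (A (3 + N + j)) (wset A N M i j x) else wset A N M i j x)"
  by (auto simp: wset_def less_Suc_eq)

lemma wset_next_row: "wset A N M (Suc i) 0 x = wset A N M i M x"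
  by (auto simp: wset_def less_Suc_eq)

lemma wp_weights_inner:
  assumes "reg \<sigma> ''N'' = N" "reg \<sigma> ''M'' = M" "arr \<sigma> ''in'' = A" "reg \<sigma> ''a'' = A (3 + i)"
    "reg \<sigma> ''j'' = 0" "reg \<sigma> ''o'' = 3 + N + M + i * M"
    "\<forall>x. top_of (wset A N M i 0 x) (arr \<sigma> ''w'' x)"
  shows "wp weights_inner \<sigma> (\<lambda>t \<tau>. t \<le> M * 54 + 4 \<and>
    reg \<tau> ''o'' = 3 + N + M + Suc i * M \<and>
    (\<forall>x. top_of (wset A N M (Suc i) 0 x) (arr \<tau> ''w'' x)))"
  unfolding weights_inner_def
\<comment> \<open>Here and in the later loops \<open>B\<close> is a rounded-up bound for the body.
  The test with its branch costs 4, which gives 54 per iteration.\<close>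
proof (rule wp_frame, rule wp_While[where n = M and B = 50 and I = "\<lambda>j \<tau>. reg \<tau> ''j'' = j \<and>
    reg \<tau> ''o'' = 3 + N + M + i * M + j \<and> (\<forall>x. top_of (wset A N M i j x) (arr \<tau> ''w'' x))"],
    goal_cases)
  case (2 j \<tau>)
  have f: "reg \<tau> ''N'' = N" "reg \<tau> ''M'' = M" "arr \<tau> ''in'' = A" "reg \<tau> ''a'' = A (3 + i)"
    using 2(1) assms by (simp_all add: frame_def)
  have o: "reg \<tau> ''o'' = 3 + N + M + i * M + j" "reg \<tau> ''j'' = j" using 2(2) by simp_all
  have top: "top_of (wset A N M i j x) (arr \<tau> ''w'' x)" for x using 2(2) by simp
  show ?case
    using 2(3) by (simp add: f o top wset_Suc top_of_insert[OF top])
next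
  case (4 t \<tau>)
  then show ?case by (simp add: wset_next_row)
qed (use assms in \<open>simp_all add: frame_def\<close>)

lemma wp_weights:
  assumes "reg \<sigma> ''N'' = N" "reg \<sigma> ''M'' = M" "arr \<sigma> ''in'' = A"
    "reg \<sigma> ''o'' = 3 + N + M" "\<forall>x. arr \<sigma> ''w'' x = 0"
  shows "wp weights \<sigma> (\<lambda>t \<tau>. t \<le> N * (M * 54 + 54) + 6 \<and>
    (\<forall>x. top_of (wset A N M N 0 x) (arr \<tau> ''w'' x)))"
  unfolding weights_def wp_Seq wp_Assign
proof (rule wp_frame, rule wp_While[where n = N and B = "M * 54 + 50" and I = "\<lambda>i \<tau>. reg \<tau> ''i'' = i \<and>
    reg \<tau> ''o'' = 3 + N + M + i * M \<and> (\<forall>x. top_of (wset A N M i 0 x) (arr \<tau> ''w'' x))"],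
    goal_cases)
  case 1
  then show ?case using assms by (simp add: wset_def)
next
  case (2 i \<tau>)
  have f: "reg \<tau> ''N'' = N" "reg \<tau> ''M'' = M" "arr \<tau> ''in'' = A"
    using 2(1) assms by (simp_all add: frame_def weights_inner_def)
  show ?case
    unfolding wp_Seq wp_Assign
  proof (rule conjI, goal_cases)
    case 1
    then show ?case using 2 f by simp
  next
    case 2
    show ?case
      by (rule wp_weights_inner[where i = i and A = A and N = N and M = M, THEN wp_frame])
        (use \<open>i < N\<close> \<open>reg \<tau> ''i'' = i \<and> _\<close> f in \<open>simp_all add: frame_def weights_inner_def\<close>)
  qed
next
  case (3 \<tau>)
  then show ?case using assms by (simp add: frame_def weights_inner_def)
next
  case (4 t \<tau>)
  have "t \<le> N * (M * 54 + 54) + 4" using 4(2)[THEN conjunct1] by (simp add: algebra_simps)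
  then show ?case using 4(2) by simp
qed

section \<open>Second pass: greedy schedule and prefix maxima\<close>

definition scan :: com where
  "scan =
     While (Less (Reg ''x'') (Plus (Reg ''N'') (Const 1)))
      (Seq (Cond (Conj (Equal (Arr ''used'' (Reg ''x'')) (Const 0)) (Equal (Reg ''s'') (Const 0)))
             (Seq (Cond (Less (Reg ''x'') (Plus (Plus (Reg ''p'') (Reg ''k'')) (Const 1)))
                    (Cond (Equal (Reg ''b'') (Const 0))
                      (Assign ''b'' (Reg ''x''))
                      (Cond (Less (Arr ''w'' (Reg ''x'')) (Arr ''w'' (Reg ''b'')))
                        (Assign ''b'' (Reg ''x'')) Skip))
                    Skip)
             (Seq (Cond (Equal (Plus (Reg ''p'') (Reg ''c'')) (Plus (Reg ''x'') (Reg ''k'')))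
                    (Assign ''s'' (Const 1)) Skip)
                  (Assign ''c'' (Plus (Reg ''c'') (Const 1)))))
             Skip)
           (Assign ''x'' (Plus (Reg ''x'') (Const 1))))"

text \<open>The register \<open>J\<close> is the running maximum of the weights placed so far; the
  array \<open>J\<close> stores its value under the label of each placed student, where the last
  pass looks it up.\<close>

definition schedule :: com where
  "schedule =
     Seq (Assign ''p'' (Const 1))
     (While (Less (Reg ''p'') (Plus (Reg ''N'') (Const 1)))
      (Seq (Assign ''x'' (Const 1))
      (Seq (Assign ''c'' (Const 0))
      (Seq (Assign ''b'' (Const 0))
      (Seq (Assign ''s'' (Const 0))
      (Seq scan
      (Seq (Store ''g'' (Reg ''p'') (Reg ''b''))
      (Seq (Store ''used'' (Reg ''b'') (Const 1))
      (Seq (Cond (Less (Reg ''J'') (Arr ''w'' (Reg ''b''))) (Assign ''J'' (Arr ''w'' (Reg ''b''))) Skip)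
      (Seq (Store ''J'' (Reg ''b'') (Reg ''J''))
           (Assign ''p'' (Plus (Reg ''p'') (Const 1)))))))))))))"

text \<open>Labels start at 1, so \<open>b = 0\<close> means that no candidate has been found. A
  nonzero \<open>s\<close> records that a tight student has been passed; from then on no further
  candidate can occur and the count \<open>c\<close> is no longer maintained.\<close>

definition scanned ::
  "nat \<Rightarrow> nat set \<Rightarrow> nat \<Rightarrow> (nat \<Rightarrow> nat) \<Rightarrow> nat \<Rightarrow> nat \<Rightarrow> nat \<Rightarrow> nat \<Rightarrow> bool" where
  "scanned k U p w x c b s \<longleftrightarrow>
     (s = 0 \<longrightarrow> c = card {v\<in>U. v < x} \<and> (\<forall>z\<in>U. z < x \<longrightarrow> \<not> tight k U p z)) \<and>
     (s \<noteq> 0 \<longrightarrow> (\<exists>z\<in>U. z < x \<and> tight k U p z)) \<and>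
     (b \<noteq> 0 \<longrightarrow> cand k U p b) \<and>
     (\<forall>y<x. cand k U p y \<longrightarrow> b \<noteq> 0 \<and> w b \<le> w y)"

text \<open>The student \<open>x\<close> is either already placed or blocked by a tight one, hence
  no candidate; while \<open>s = 0\<close> the count does not change either.\<close>

lemma scanned_skip:
  assumes "scanned k U p w x c b s" "x \<notin> U \<or> s \<noteq> 0"
  shows "scanned k U p w (Suc x) c b s"
proof -
  have nc: "\<not> cand k U p x" using assms by (auto simp: scanned_def cand_def)
  show ?thesis
  proof (cases "s = 0")
    case True
    then have "{v\<in>U. v < Suc x} = {v\<in>U. v < x}"
      using assms(2) by (auto simp: less_Suc_eq)
    then show ?thesis
      using assms True nc unfolding scanned_def by (auto simp del: Collect_conj_eq simp: less_Suc_eq)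
  next
    case False
    then show ?thesis
      using assms nc unfolding scanned_def by (auto simp: less_Suc_eq)
  qed
qed

text \<open>As long as no tight student has been met, candidacy of \<open>x\<close> reduces to
  \<open>x \<le> p + k\<close>, and \<open>c\<close> is the cardinality in \<open>tight\<close>.
  Tightness of \<open>x\<close> affects only later students, so \<open>x\<close> may be chosen and
  raise the flag in the same step.\<close>

lemma scanned_step:
  assumes "scanned k U p w x c b 0" "x \<in> U" "finite U" "x \<noteq> 0"
    and "b' = (if x \<le> p + k \<and> (b = 0 \<or> w x < w b) then x else b)"
    and "s' = (if p + c = x + k then 1 else 0)"
  shows "scanned k U p w (Suc x) (Suc c) b' s'"
proof -
  have c: "c = card {v\<in>U. v < x}" and nt: "\<forall>z\<in>U. z < x \<longrightarrow> \<not> tight k U p z"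
    using assms by (auto simp: scanned_def)
  have x: "cand k U p x \<longleftrightarrow> x \<le> p + k" "tight k U p x \<longleftrightarrow> p + c = x + k"
    using nt assms(2) c by (auto simp: cand_def tight_def)
  have "{v\<in>U. v < Suc x} = insert x {v\<in>U. v < x}"
    using assms(2) by auto
  then have "card {v\<in>U. v < Suc x} = Suc c" using c assms(3) by simp
  then show ?thesis
    using assms nt x unfolding scanned_def by (auto simp: less_Suc_eq simp del: Collect_conj_eq)
qed

lemma wp_scan:
  assumes "reg \<sigma> ''N'' = N" "reg \<sigma> ''k'' = k" "reg \<sigma> ''p'' = p" "arr \<sigma> ''w'' = w"
    "reg \<sigma> ''x'' = 1" "reg \<sigma> ''c'' = 0" "reg \<sigma> ''b'' = 0" "reg \<sigma> ''s'' = 0"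
    and U: "U \<subseteq> {1..N}" "\<forall>y\<in>{1..N}. arr \<sigma> ''used'' y = 0 \<longleftrightarrow> y \<in> U"
    and ex: "\<exists>y. cand k U p y"
  shows "wp scan \<sigma> (\<lambda>t \<tau>. t \<le> N * 106 + 6 \<and>
    cand k U p (reg \<tau> ''b'') \<and> (\<forall>y. cand k U p y \<longrightarrow> w (reg \<tau> ''b'') \<le> w y))"
  unfolding scan_def
proof (rule wp_frame, rule wp_While[where n = N and B = 100 and I = "\<lambda>i \<tau>. reg \<tau> ''x'' = Suc i \<and>
    scanned k U p w (Suc i) (reg \<tau> ''c'') (reg \<tau> ''b'') (reg \<tau> ''s'')"],
    goal_cases)
  case 1
  have "0 \<notin> U" using U by auto
  then have "{v\<in>U. v < Suc 0} = {}" "\<not> cand k U p 0" by (auto simp: cand_def)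
  then show ?case using assms by (auto simp: scanned_def)
next
  case (2 i \<tau>)
  have fin: "finite U" using U(1) finite_subset by blast
  have f: "reg \<tau> ''N'' = N" "reg \<tau> ''k'' = k" "reg \<tau> ''p'' = p" "arr \<tau> ''w'' = w"
    "arr \<tau> ''used'' = arr \<sigma> ''used''"
    using 2(1) assms by (auto simp: frame_def)
  show ?case
  proof (cases "Suc i \<in> U \<and> reg \<tau> ''s'' = 0")
    case True
    then have "arr \<sigma> ''used'' (Suc i) = 0" using U 2(3) by auto
    then show ?thesis
      using True 2(2,3) f fin
      by (auto intro!: scanned_step[where b = "reg \<tau> ''b''"])
  next
    case False
    then have "\<not> (arr \<sigma> ''used'' (Suc i) = 0 \<and> reg \<tau> ''s'' = 0)" using U 2(3) by auto
    moreover have "scanned k U p w (Suc (Suc i)) (reg \<tau> ''c'') (reg \<tau> ''b'') (reg \<tau> ''s'')"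
      by (rule scanned_skip) (use False 2(2) in auto)
    ultimately show ?thesis
      using 2(2,3) by (cases "arr \<sigma> ''used'' (Suc i) = 0") (simp_all add: f)
  qed
next
  case (3 \<tau>)
  then show ?case using assms by (auto simp: frame_def)
next
  case (4 t \<tau>)
  \<comment> \<open>All candidates have labels at most \<open>N\<close>, so the scan has met every
    one of them; since one exists, \<open>b\<close> has left its default 0.\<close>
  have "y < Suc N" if "cand k U p y" for y
    using that U by (auto simp: cand_def)
  moreover have sc: "reg \<tau> ''b'' \<noteq> 0 \<longrightarrow> cand k U p (reg \<tau> ''b'')"
    "\<forall>y<Suc N. cand k U p y \<longrightarrow> reg \<tau> ''b'' \<noteq> 0 \<and> w (reg \<tau> ''b'') \<le> w y"
    using 4(2) unfolding scanned_def by blast+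
  ultimately have min: "reg \<tau> ''b'' \<noteq> 0 \<and> w (reg \<tau> ''b'') \<le> w y" if "cand k U p y" for y
    using that by blast
  then have "cand k U p (reg \<tau> ''b'')" using sc(1) ex by blast
  then show ?case using 4(2)[THEN conjunct1] min by simp
qed

text \<open>The situation after \<open>i\<close> positions are filled: \<open>u\<close> stands for
  the array \<open>used\<close>, and \<open>J\<close> and \<open>h\<close> for the register and the
  array named \<open>J\<close>.\<close>

definition scheduled :: "nat \<Rightarrow> nat \<Rightarrow> (nat \<Rightarrow> nat) \<Rightarrow> nat \<Rightarrow>
    (nat \<Rightarrow> nat) \<Rightarrow> (nat \<Rightarrow> nat) \<Rightarrow> nat \<Rightarrow> (nat \<Rightarrow> nat) \<Rightarrow> bool" where
  "scheduled N k w i g u J h \<longleftrightarrow> greedy N k w g i \<and>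
     (\<forall>y\<in>{1..N}. u y = 0 \<longleftrightarrow> y \<in> rest N g (Suc i)) \<and>
     top_of (w ` g ` {1..i}) J \<and>
     (\<forall>q\<in>{1..i}. top_of (w ` g ` {1..q}) (h (g q)))"

lemma scheduled_Suc:
  assumes s: "scheduled N k w i g u J h"
    and b: "cand k (rest N g (Suc i)) (Suc i) b"
      "\<forall>y. cand k (rest N g (Suc i)) (Suc i) y \<longrightarrow> w b \<le> w y"
    and J': "J' = (if J < w b then w b else J)"
  shows "scheduled N k w (Suc i) (g(Suc i := b)) (u(b := 1)) J' (h(b := J'))"
proof -
  let ?g = "g(Suc i := b)"
  have bU: "b \<in> rest N g (Suc i)" using b by (simp add: cand_def)
  have gr: "greedy N k w ?g (Suc i)"
    using s b by (intro greedy_Suc) (auto simp: scheduled_def)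
  have r: "rest N ?g (Suc i) = rest N g (Suc i)" by (intro rest_cong) auto
  have u: "(u(b := 1)) y = 0 \<longleftrightarrow> y \<in> rest N ?g (Suc (Suc i))" if "y \<in> {1..N}" for y
    using s that by (auto simp: rest_Suc[of "Suc i"] r scheduled_def)
  have im: "?g ` {1..q} = g ` {1..q}" if "q \<le> i" for q
    using that by (intro image_cong) auto
  have "{1..Suc i} = insert (Suc i) {1..i}" by auto
  then have "w ` ?g ` {1..Suc i} = insert (w b) (w ` g ` {1..i})"
    by (simp only: image_insert im[OF order_refl] fun_upd_same)
  then have top: "top_of (w ` ?g ` {1..Suc i}) J'"
    using s by (auto simp: J' scheduled_def intro: top_of_insert)
  have "top_of (w ` ?g ` {1..q}) ((h(b := J')) (?g q))" if "q \<in> {1..Suc i}" for q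
  proof (cases "q = Suc i")
    case True
    then show ?thesis using top by simp
  next
    case False
    then have q: "q \<in> {1..i}" using that by auto
    \<comment> \<open>The new student has not been placed before, so writing at \<open>b\<close>
      keeps the maxima recorded for earlier positions.\<close>
    then have "g q \<noteq> b" using bU by (auto simp: rest_def)
    then show ?thesis using s q False im[of q] by (auto simp: scheduled_def)
  qed
  then show ?thesis using gr u top by (simp only: scheduled_def) blast
qed

lemma wp_schedule:
  assumes "reg \<sigma> ''N'' = N" "reg \<sigma> ''k'' = k" "reg \<sigma> ''J'' = 0" "arr \<sigma> ''w'' = w"
    and "\<forall>y. arr \<sigma> ''used'' y = 0"
  shows "wp schedule \<sigma> (\<lambda>t \<tau>. t \<le> N * (N * 106 + 106) + 8 \<and>
    greedy N k w (arr \<tau> ''g'') N \<and>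
    (\<forall>q\<in>{1..N}. top_of (w ` arr \<tau> ''g'' ` {1..q}) (arr \<tau> ''J'' (arr \<tau> ''g'' q))))"
  unfolding schedule_def wp_Seq wp_Assign
proof (rule wp_frame, rule wp_While[where n = N and B = "N * 106 + 100" and I = "\<lambda>i \<tau>.
    reg \<tau> ''p'' = Suc i \<and> scheduled N k w i (arr \<tau> ''g'') (arr \<tau> ''used'') (reg \<tau> ''J'') (arr \<tau> ''J'')"],
    goal_cases)
  case 1
  then show ?case using assms by (auto simp: greedy_def rest_def scheduled_def)
next
  case (2 i \<tau>)
  let ?U = "rest N (arr \<tau> ''g'') (Suc i)"
  have f: "reg \<tau> ''N'' = N" "reg \<tau> ''k'' = k" "arr \<tau> ''w'' = w" "reg \<tau> ''p'' = Suc i"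
    using 2(1,2) assms by (simp_all add: frame_def scan_def)
  have s: "scheduled N k w i (arr \<tau> ''g'') (arr \<tau> ''used'') (reg \<tau> ''J'') (arr \<tau> ''J'')"
    using 2(2) by simp
  have used: "\<forall>y\<in>{1..N}. arr \<tau> ''used'' y = 0 \<longleftrightarrow> y \<in> ?U"
    using s by (simp add: scheduled_def)
  have ex: "\<exists>y. cand k ?U (Suc i) y" using 2(3) by (intro cand_exists) auto
  show ?case
    unfolding wp_Seq wp_Assign
  proof (rule conjI, goal_cases)
    case 1
    then show ?case using 2(3) f by simp
  next
    case 2
    show ?case
    proof (rule wp_scan[where U = ?U and p = "Suc i" and k = k and N = N and w = w, THEN wp_frame],
        goal_cases)
      case (12 t \<tau>')
      have f': "reg \<tau>' ''p'' = Suc i" "reg \<tau>' ''J'' = reg \<tau> ''J''" "arr \<tau>' = arr \<tau>"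
        using 12(1) f(4) by (auto simp: frame_def scan_def)
      note scheduled_Suc[OF s 12(2)[THEN conjunct2, THEN conjunct1]
          12(2)[THEN conjunct2, THEN conjunct2] refl]
      then show ?case
        using 12(2)[THEN conjunct1]
        by (cases "reg \<tau> ''J'' < w (reg \<tau>' ''b'')") (simp_all add: f' f(3))
    qed (use f ex used in \<open>simp_all add: rest_def del: atLeastAtMost_iff\<close>)
  qed
next
  case (3 \<tau>)
  then show ?case using assms by (simp add: frame_def scan_def)
next
  case (4 t \<tau>)
  then have "scheduled N k w N (arr \<tau> ''g'') (arr \<tau> ''used'') (reg \<tau> ''J'') (arr \<tau> ''J'')" by blast
  moreover have "t \<le> N * (N * 106 + 106) + 6" using 4(2)[THEN conjunct1] by (simp add: algebra_simps)
  ultimately show ?case by (simp add: scheduled_def)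
qed

section \<open>Third pass: listing the added edges\<close>

definition emit_inner :: com where
  "emit_inner =
     While (Less (Reg ''j'') (Reg ''M''))
      (Seq (Cond (Conj (Equal (Arr ''in'' (Reg ''o'')) (Const 0))
                   (Less (Arr ''in'' (Plus (Plus (Const 3) (Reg ''N'')) (Reg ''j'')))
                     (Plus (Arr ''J'' (Reg ''a'')) (Const 1))))
             (Seq (Store ''out'' (Reg ''e'') (Reg ''i''))
             (Seq (Store ''out'' (Plus (Reg ''e'') (Const 1)) (Reg ''j''))
             (Seq (Assign ''e'' (Plus (Reg ''e'') (Const 2)))
                  (Assign ''n'' (Plus (Reg ''n'') (Const 1))))))
             Skip)
      (Seq (Assign ''o'' (Plus (Reg ''o'') (Const 1)))
           (Assign ''j'' (Plus (Reg ''j'') (Const 1)))))"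

text \<open>Cell 0 of \<open>out\<close> is reserved for the count and written last. The register
  \<open>e\<close> tracks the next free cell \<open>2 * n + 1\<close> by steps of 2, again without
  multiplication.\<close>

definition emit :: com where
  "emit =
     Seq (Assign ''i'' (Const 0))
     (Seq (Assign ''o'' (Plus (Plus (Const 3) (Reg ''N'')) (Reg ''M'')))
     (Seq (Assign ''n'' (Const 0))
     (Seq (Assign ''e'' (Const 1))
     (Seq (While (Less (Reg ''i'') (Reg ''N''))
            (Seq (Assign ''a'' (Arr ''in'' (Plus (Const 3) (Reg ''i''))))
            (Seq (Assign ''j'' (Const 0))
            (Seq emit_inner
                 (Assign ''i'' (Plus (Reg ''i'') (Const 1)))))))
          (Store ''out'' (Const 0) (Reg ''n''))))))"

definition selected :: "(nat \<Rightarrow> nat) \<Rightarrow> (nat \<Rightarrow> nat) \<Rightarrow> nat \<Rightarrow> nat \<Rightarrow> nat \<Rightarrow> nat \<Rightarrow> bool" where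
  "selected A J N M i j \<longleftrightarrow> A (3 + N + M + i * M + j) = 0 \<and> A (3 + N + j) \<le> J (A (3 + i))"

definition lists_pairs :: "(nat \<Rightarrow> nat) \<Rightarrow> (nat \<times> nat) list \<Rightarrow> bool" where
  "lists_pairs out ps \<longleftrightarrow> (\<forall>l<length ps. (out (2 * l + 1), out (2 * l + 2)) = ps ! l)"

definition emitted :: "(nat \<Rightarrow> nat) \<Rightarrow> (nat \<Rightarrow> nat) \<Rightarrow> nat \<Rightarrow> nat \<Rightarrow> nat \<Rightarrow> nat \<Rightarrow>
    (nat \<Rightarrow> nat) \<Rightarrow> nat \<Rightarrow> nat \<Rightarrow> bool" where
  "emitted A J N M i j out n e \<longleftrightarrow> e = Suc (2 * n) \<and>
     (\<exists>ps. length ps = n \<and> distinct ps \<and> lists_pairs out ps \<and>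
        set ps = {(i', j'). (i' < i \<and> j' < M \<or> i' = i \<and> j' < j) \<and> selected A J N M i' j'})"

lemma emitted_skip:
  assumes "\<not> selected A J N M i j" "emitted A J N M i j out n e"
  shows "emitted A J N M i (Suc j) out n e"
proof -
  have "{(i', j'). (i' < i \<and> j' < M \<or> i' = i \<and> j' < Suc j) \<and> selected A J N M i' j'} =
      {(i', j'). (i' < i \<and> j' < M \<or> i' = i \<and> j' < j) \<and> selected A J N M i' j'}"
    using assms(1) by (auto simp: less_Suc_eq)
  then show ?thesis using assms(2) by (simp only: emitted_def)
qed

text \<open>The two cells written lie beyond those of the old list, which end at
  \<open>2 * n\<close>, and the pair \<open>(i, j)\<close> is new because the old list stops before
  column \<open>j\<close> of row \<open>i\<close>.\<close>

lemma emitted_add: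
  assumes "selected A J N M i j" "emitted A J N M i j out n e"
  shows "emitted A J N M i (Suc j) (out(e := i, Suc e := j)) (Suc n) (Suc (Suc e))"
proof -
  have "{(i', j'). (i' < i \<and> j' < M \<or> i' = i \<and> j' < Suc j) \<and> selected A J N M i' j'} =
      insert (i, j) {(i', j'). (i' < i \<and> j' < M \<or> i' = i \<and> j' < j) \<and> selected A J N M i' j'}"
    using assms(1) by (auto simp: less_Suc_eq)
  moreover obtain ps where ps: "length ps = n" "distinct ps" "lists_pairs out ps"
    "set ps = {(i', j'). (i' < i \<and> j' < M \<or> i' = i \<and> j' < j) \<and> selected A J N M i' j'}"
    and e: "e = Suc (2 * n)"
    using assms(2) by (auto simp: emitted_def)
  moreover have "lists_pairs (out(e := i, Suc e := j)) (ps @ [(i, j)])"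
    using ps(1,3) e by (auto simp: lists_pairs_def nth_append less_Suc_eq)
  ultimately show ?thesis
    unfolding emitted_def by (intro conjI exI[of _ "ps @ [(i, j)]"]) auto
qed

lemma emitted_next_row: "emitted A J N M (Suc i) 0 = emitted A J N M i M"
proof -
  have "{(i', j'). (i' < Suc i \<and> j' < M \<or> i' = Suc i \<and> j' < 0) \<and> selected A J N M i' j'} =
      {(i', j'). (i' < i \<and> j' < M \<or> i' = i \<and> j' < M) \<and> selected A J N M i' j'}"
    by (auto simp: less_Suc_eq)
  then show ?thesis by (simp only: emitted_def fun_eq_iff) simp
qed

lemma wp_emit_inner:
  assumes "reg \<sigma> ''N'' = N" "reg \<sigma> ''M'' = M" "arr \<sigma> ''in'' = A" "arr \<sigma> ''J'' = J"
    "reg \<sigma> ''i'' = i" "reg \<sigma> ''a'' = A (3 + i)" "reg \<sigma> ''j'' = 0"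
    "reg \<sigma> ''o'' = 3 + N + M + i * M"
    "emitted A J N M i 0 (arr \<sigma> ''out'') (reg \<sigma> ''n'') (reg \<sigma> ''e'')"
  shows "wp emit_inner \<sigma> (\<lambda>t \<tau>. t \<le> M * 84 + 4 \<and>
    reg \<tau> ''o'' = 3 + N + M + Suc i * M \<and>
    emitted A J N M (Suc i) 0 (arr \<tau> ''out'') (reg \<tau> ''n'') (reg \<tau> ''e''))"
  unfolding emit_inner_def
proof (rule wp_frame, rule wp_While[where n = M and B = 80 and I = "\<lambda>j \<tau>. reg \<tau> ''j'' = j \<and>
    reg \<tau> ''o'' = 3 + N + M + i * M + j \<and>
    emitted A J N M i j (arr \<tau> ''out'') (reg \<tau> ''n'') (reg \<tau> ''e'')"], goal_cases)
  case (2 j \<tau>)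
  have f: "reg \<tau> ''N'' = N" "reg \<tau> ''M'' = M" "arr \<tau> ''in'' = A" "arr \<tau> ''J'' = J"
    "reg \<tau> ''i'' = i" "reg \<tau> ''a'' = A (3 + i)"
    using 2(1) assms by (simp_all add: frame_def)
  have o: "reg \<tau> ''o'' = 3 + N + M + i * M + j" "reg \<tau> ''j'' = j" using 2(2) by simp_all
  have em: "emitted A J N M i j (arr \<tau> ''out'') (reg \<tau> ''n'') (reg \<tau> ''e'')" using 2(2) by simp
  show ?case
  proof (cases "selected A J N M i j")
    case True
    then show ?thesis
      using 2(3) emitted_add[OF True em] by (simp add: f o selected_def less_Suc_eq_le)
  next
    case False
    then show ?thesis
      using 2(3) emitted_skip[OF False em]
      by (cases "A (3 + N + M + i * M + j) = 0") (simp_all add: f o selected_def less_Suc_eq_le)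
  qed
next
  case (4 t \<tau>)
  then show ?case by (simp add: emitted_next_row)
qed (use assms in \<open>simp_all add: frame_def\<close>)

lemma wp_emit:
  assumes "reg \<sigma> ''N'' = N" "reg \<sigma> ''M'' = M" "arr \<sigma> ''in'' = A" "arr \<sigma> ''J'' = J"
  shows "wp emit \<sigma> (\<lambda>t \<tau>. t \<le> N * (M * 84 + 84) + 20 \<and>
    (\<exists>ps. distinct ps \<and> set ps = {(i, j). i < N \<and> j < M \<and> selected A J N M i j} \<and>
       arr \<tau> ''out'' 0 = length ps \<and> lists_pairs (arr \<tau> ''out'') ps))"
  unfolding emit_def wp_Seq wp_Assign
proof (rule wp_frame, rule wp_While[where n = N and B = "M * 84 + 80" and I = "\<lambda>i \<tau>. reg \<tau> ''i'' = i \<and>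
    reg \<tau> ''o'' = 3 + N + M + i * M \<and>
    emitted A J N M i 0 (arr \<tau> ''out'') (reg \<tau> ''n'') (reg \<tau> ''e'')"], goal_cases)
  case 1
  then show ?case using assms by (simp add: emitted_def lists_pairs_def)
next
  case (2 i \<tau>)
  have f: "reg \<tau> ''N'' = N" "reg \<tau> ''M'' = M" "arr \<tau> ''in'' = A" "arr \<tau> ''J'' = J"
    using 2(1) assms by (simp_all add: frame_def emit_inner_def)
  have i: "reg \<tau> ''i'' = i" "reg \<tau> ''o'' = 3 + N + M + i * M"
    "emitted A J N M i 0 (arr \<tau> ''out'') (reg \<tau> ''n'') (reg \<tau> ''e'')"
    using 2(2) by simp_all
  show ?case
    unfolding wp_Seq wp_Assign
  proof (rule conjI, goal_cases)
    case 1
    then show ?case using 2(3) f i by simp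
  next
    case 2
    show ?case
    proof (rule wp_emit_inner[where i = i and A = A and N = N and M = M and J = J, THEN wp_frame],
        goal_cases)
      case (10 t \<tau>')
      have "reg \<tau>' ''i'' = i" using 10(1) i by (simp add: frame_def emit_inner_def)
      then show ?case using 10(2) by simp
    qed (simp_all add: f i)
  qed
next
  case (3 \<tau>)
  then show ?case using assms by (simp add: frame_def emit_inner_def)
next
  case (4 t \<tau>)
  have t: "t \<le> N * (M * 84 + 84) + 4" using 4(2)[THEN conjunct1] by (simp add: algebra_simps)
  obtain ps where ps: "length ps = reg \<tau> ''n''" "distinct ps" "lists_pairs (arr \<tau> ''out'') ps"
    "set ps = {(i, j). i < N \<and> j < M \<and> selected A J N M i j}"
    using 4(2) by (auto simp: emitted_def)
  \<comment> \<open>Pairs occupy cells from 1 on, so storing the count in cell 0 does not disturb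
    them.\<close>
  have "lists_pairs ((arr \<tau> ''out'')(0 := length ps)) ps"
    using ps(3) by (simp add: lists_pairs_def)
  then show ?case using t ps by auto
qed

section \<open>The complete program and its running time\<close>

definition cnca_prog :: com where
  "cnca_prog =
     Seq (Assign ''N'' (Arr ''in'' (Const 0)))
     (Seq (Assign ''M'' (Arr ''in'' (Const 1)))
     (Seq (Assign ''k'' (Arr ''in'' (Const 2)))
     (Seq (Assign ''o'' (Plus (Plus (Const 3) (Reg ''N'')) (Reg ''M'')))
     (Seq weights (Seq schedule emit)))))"

lemma wp_cnca_prog:
  assumes A: "A = arr (input_state xs) ''in''" and "A 0 = N" "A 1 = M" "A 2 = k"
  shows "wp cnca_prog (input_state xs) (\<lambda>t \<tau>. t \<le> 250 * (N * N + N * M + N) + 60 \<and>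
    (\<exists>w g J ps. (\<forall>x. top_of (wset A N M N 0 x) (w x)) \<and> greedy N k w g N \<and>
       (\<forall>q\<in>{1..N}. top_of (w ` g ` {1..q}) (J (g q))) \<and>
       distinct ps \<and> set ps = {(i, j). i < N \<and> j < M \<and> selected A J N M i j} \<and>
       arr \<tau> ''out'' 0 = length ps \<and> lists_pairs (arr \<tau> ''out'') ps))"
  unfolding cnca_prog_def wp_Seq wp_Assign
proof (rule wp_weights[where A = A and N = N and M = M, THEN wp_frame], goal_cases)
  case (6 t\<^sub>1 \<tau>\<^sub>1)
  \<comment> \<open>The first pass writes neither register \<open>J\<close> nor array
    \<open>used\<close>, so both still hold their initial zeros.\<close>
  have 1: "reg \<tau>\<^sub>1 ''N'' = N" "reg \<tau>\<^sub>1 ''M'' = M" "reg \<tau>\<^sub>1 ''k'' = k" "reg \<tau>\<^sub>1 ''J'' = 0"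
    "arr \<tau>\<^sub>1 ''in'' = A" "\<forall>y. arr \<tau>\<^sub>1 ''used'' y = 0"
    using 6(1) assms by (simp_all add: frame_def weights_def weights_inner_def input_state_def)
  note w = 6(2)
  show ?case
  proof (rule wp_schedule[where N = N and k = k and w = "arr \<tau>\<^sub>1 ''w''", THEN wp_frame], goal_cases)
    case (6 t\<^sub>2 \<tau>\<^sub>2)
    have 2: "reg \<tau>\<^sub>2 ''N'' = N" "reg \<tau>\<^sub>2 ''M'' = M" "arr \<tau>\<^sub>2 ''in'' = A"
      using 6(1) 1 by (simp_all add: frame_def schedule_def scan_def)
    note g = 6(2)
    show ?case
    proof (rule wp_emit[where N = N and M = M and A = A and J = "arr \<tau>\<^sub>2 ''J''", THEN wp_frame], goal_cases)
      case (5 t\<^sub>3 \<tau>\<^sub>3)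
      \<comment> \<open>The coefficients add up to 106 for \<open>N * N\<close>, 138 for
        \<open>N * M\<close> and 244 for \<open>N\<close>, all below 250, with constant 34. The four
        initial assignments cost 15 more, within the remaining slack up to 60.\<close>
      have "t\<^sub>1 \<le> 54 * (N * M) + 54 * N + 6" "t\<^sub>2 \<le> 106 * (N * N) + 106 * N + 8"
        "t\<^sub>3 \<le> 84 * (N * M) + 84 * N + 20"
        using w[THEN conjunct1] g[THEN conjunct1] 5(2)[THEN conjunct1] by (simp_all add: algebra_simps)
      then have "t\<^sub>1 + (t\<^sub>2 + t\<^sub>3) \<le> 250 * (N * N + N * M + N) + 34"
        unfolding add_mult_distrib2 by linarith
      moreover note w[THEN conjunct2] g[THEN conjunct2] 5(2)[THEN conjunct2]
      ultimately show ?case by (intro conjI) (simp, blast)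
    qed (use 2 in simp_all)
  qed (use 1 in simp_all)
qed (use assms in \<open>simp_all add: input_state_def\<close>)

subsection \<open>Optimality\<close>

lemma prefix_image:
  assumes "ordering Q \<beta>" "j \<le> card Q"
  shows "inv_into Q \<beta> ` {1..j} = {q \<in> Q. \<beta> q \<le> j}"
proof -
  have b: "bij_betw \<beta> Q {1..card Q}" using assms(1) by (simp add: ordering_def)
  show ?thesis
  proof (intro equalityI subsetI)
    fix q assume "q \<in> inv_into Q \<beta> ` {1..j}"
    then obtain p where p: "p \<in> {1..j}" "q = inv_into Q \<beta> p" by blast
    then have "p \<in> \<beta> ` Q" using b assms(2) by (auto simp: bij_betw_def)
    then show "q \<in> {q \<in> Q. \<beta> q \<le> j}"
      using p by (simp add: inv_into_into f_inv_into_f)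
  next
    fix q assume q: "q \<in> {q \<in> Q. \<beta> q \<le> j}"
    then have "q = inv_into Q \<beta> (\<beta> q)" "\<beta> q \<in> {1..j}"
      using b by (auto simp: bij_betw_def)
    then show "q \<in> inv_into Q \<beta> ` {1..j}" by blast
  qed
qed

lemma card_prefix:
  assumes "ordering Q \<beta>" "j \<le> card Q"
  shows "card {q \<in> Q. \<beta> q \<le> j} = j"
proof -
  have "inj_on (inv_into Q \<beta>) {1..j}"
    using assms by (intro inj_on_subset[OF inj_on_inv_into[OF subset_refl]])
      (auto simp: ordering_def bij_betw_def)
  from card_image[OF this] show ?thesis unfolding prefix_image[OF assms] by simp
qed

lemma card_edges:
  assumes "finite S" "finite Q" "E \<subseteq> S \<times> Q"
  shows "card E = (\<Sum>s\<in>S. card (nbh E s))"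
proof -
  have "E = (SIGMA s:S. nbh E s)" using assms(3) by (auto simp: nbh_def)
  moreover have "finite (nbh E s)" for s
    using assms by (intro finite_subset[OF _ assms(2)]) (auto simp: nbh_def)
  ultimately show ?thesis using assms(1) card_SigmaI by metis
qed

text \<open>The interval property makes the enlarged neighbourhood an initial segment whose length
  is its size. It contains the old neighbourhood, so this length reaches the largest \<beta>-value
  there.\<close>

lemma feasible_degree_ge:
  assumes inst: "cnca_instance S Q E \<alpha> \<beta> k"
    and w: "\<And>s. s \<in> S \<Longrightarrow> top_of (\<beta> ` nbh E s) (w (\<alpha> s))"
    and ip: "interval_property S Q (E \<union> F) \<beta>" and s: "s \<in> S"
  shows "w (\<alpha> s) \<le> card (nbh (E \<union> F) s)"
proof -
  have \<beta>: "ordering Q \<beta>" using inst by (simp add: cnca_instance_def)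
  obtain j where j: "j \<le> card Q" "nbh (E \<union> F) s = inv_into Q \<beta> ` {1..j}"
    using ip s by (auto simp: interval_property_def)
  have eq: "nbh (E \<union> F) s = {q \<in> Q. \<beta> q \<le> j}" using j prefix_image[OF \<beta>] by simp
  then have "card (nbh (E \<union> F) s) = j" using card_prefix[OF \<beta> j(1)] by simp
  moreover have "\<beta> q \<le> j" if "q \<in> nbh E s" for q
  proof -
    have "q \<in> nbh (E \<union> F) s" using that by (simp add: nbh_def)
    then show ?thesis by (simp add: eq)
  qed
  ultimately show ?thesis using w[OF s] by (auto simp: top_of_def)
qed

text \<open>Prefix maxima increase with the position, which gives nestedness; conversely, the degree
  at each position of any feasible solution is at least the greedy prefix maximum there, and summing
  over positions compares the sizes.\<close>

lemma greedy_optimal: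
  assumes inst: "cnca_instance S Q E \<alpha> \<beta> k"
    and w: "\<And>s. s \<in> S \<Longrightarrow> top_of (\<beta> ` nbh E s) (w (\<alpha> s))"
    and g: "greedy (card S) k w g (card S)"
    and J: "\<And>q. q \<in> {1..card S} \<Longrightarrow> top_of (w ` g ` {1..q}) (J (g q))"
    and F: "F = {(s, q). s \<in> S \<and> q \<in> Q \<and> (s, q) \<notin> E \<and> \<beta> q \<le> J (\<alpha> s)}"
  shows "cnca_optimal S Q E \<alpha> \<beta> k F"
proof -
  let ?N = "card S"
  have fin: "finite S" "finite Q" and E: "E \<subseteq> S \<times> Q" and \<beta>: "ordering Q \<beta>"
    and \<alpha>: "bij_betw \<alpha> S {1..?N}"
    using inst by (auto simp: cnca_instance_def ordering_def)
  have gb: "bij_betw g {1..?N} {1..?N}" using greedy_bij[OF g] .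
  \<comment> \<open>The ordering goes from students to positions, while \<open>g\<close> goes from
    positions to labels, hence the inverse.\<close>
  define \<pi> where "\<pi> = inv_into {1..?N} g \<circ> \<alpha>"
  have \<pi>: "bij_betw \<pi> S {1..?N}"
    unfolding \<pi>_def using \<alpha> bij_betw_inv_into[OF gb] by (rule bij_betw_trans)
  have \<pi>_in: "\<pi> s \<in> {1..?N}" if "s \<in> S" for s using \<pi> that bij_betwE by blast
  have g\<pi>: "g (\<pi> s) = \<alpha> s" if "s \<in> S" for s
  proof -
    have "\<alpha> s \<in> {1..?N}" using \<alpha> that bij_betwE by blast
    then have "\<alpha> s \<in> g ` {1..?N}" using gb by (simp add: bij_betw_def)
    then show ?thesis by (simp add: \<pi>_def f_inv_into_f)
  qed
  \<comment> \<open>Bounding the weights, and with them \<open>J\<close>, by \<open>card Q\<close>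
    makes \<open>J\<close> an admissible interval length and the degree exactly
    \<open>J\<close>.\<close>
  have wQ: "w x \<le> card Q" if x: "x \<in> {1..?N}" for x
  proof -
    have "x \<in> \<alpha> ` S" using x \<alpha> by (simp add: bij_betw_def)
    then obtain s where s: "s \<in> S" "x = \<alpha> s" by blast
    have "\<beta> q \<le> card Q" if "q \<in> nbh E s" for q
    proof -
      have "q \<in> Q" using that E by (auto simp: nbh_def)
      then have "\<beta> q \<in> {1..card Q}" using \<beta> bij_betwE unfolding ordering_def by blast
      then show ?thesis by simp
    qed
    then show ?thesis using w[OF s(1)] by (auto simp: top_of_def s)
  qed
  have JQ: "J (g p) \<le> card Q" if p: "p \<in> {1..?N}" for p
  proof -
    have "J (g p) = 0 \<or> (\<exists>r\<in>{1..p}. J (g p) = w (g r))" using J[OF p] by (auto simp: top_of_def)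
    moreover have "w (g r) \<le> card Q" if "r \<in> {1..p}" for r
    proof -
      have "r \<in> {1..?N}" using that p by simp
      then have "g r \<in> {1..?N}" using gb bij_betwE by blast
      then show ?thesis by (rule wQ)
    qed
    ultimately show ?thesis by auto
  qed
  have nbh: "nbh (E \<union> F) s = {q \<in> Q. \<beta> q \<le> J (\<alpha> s)}" if s: "s \<in> S" for s
  proof -
    \<comment> \<open>Student \<open>s\<close> itself occupies position \<open>\<pi> s\<close>, so
      its own weight enters the prefix maximum and all its old edges are kept.\<close>
    have "w (g (\<pi> s)) \<in> w ` g ` {1..\<pi> s}" using \<pi>_in[OF s] by auto
    then have "w (\<alpha> s) \<le> J (\<alpha> s)"
      using J[OF \<pi>_in[OF s]] g\<pi>[OF s] by (auto simp: top_of_def)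
    then have "\<beta> q \<le> J (\<alpha> s)" if "q \<in> nbh E s" for q
      using w[OF s] that by (force simp: top_of_def)
    then show ?thesis using s E by (auto simp: F nbh_def)
  qed
  have JQ': "J (\<alpha> s) \<le> card Q" if "s \<in> S" for s using JQ[OF \<pi>_in] g\<pi> that by force
  have mono: "J (g p) \<le> J (g q)" if "p \<in> {1..?N}" "q \<in> {1..?N}" "p \<le> q" for p q
  proof -
    have "w ` g ` {1..p} \<subseteq> w ` g ` {1..q}" using that by (intro image_mono) auto
    then show ?thesis using J[OF that(1)] J[OF that(2)] by (rule top_of_mono)
  qed
  have feas: "cnca_feasible S Q E \<alpha> \<beta> k F"
    unfolding cnca_feasible_def
  proof (intro conjI exI[of _ \<pi>])
    show "F \<subseteq> S \<times> Q - E" by (auto simp: F)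
    show "ordering S \<pi>" using \<pi> by (simp add: ordering_def)
    show "nested S (E \<union> F) \<pi>"
      unfolding nested_def
    proof (intro ballI impI)
      fix s\<^sub>1 s\<^sub>2 assume s: "s\<^sub>1 \<in> S" "s\<^sub>2 \<in> S" "\<pi> s\<^sub>2 \<le> \<pi> s\<^sub>1"
      then have "J (\<alpha> s\<^sub>2) \<le> J (\<alpha> s\<^sub>1)"
        using mono[OF \<pi>_in \<pi>_in] g\<pi> by force
      then show "nbh (E \<union> F) s\<^sub>2 \<subseteq> nbh (E \<union> F) s\<^sub>1" using nbh s by auto
    qed
    show "near S k \<alpha> \<pi>"
      unfolding near_def
    proof
      fix s assume s: "s \<in> S"
      then have "\<alpha> s \<le> \<pi> s + k" "\<pi> s \<le> \<alpha> s + k"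
        using greedy_near[OF g, of "\<pi> s"] \<pi>_in[OF s] g\<pi>[OF s] by auto
      then show "int (\<pi> s) \<in> {int (\<alpha> s) - int k..int (\<alpha> s) + int k}" by simp
    qed
    show "interval_property S Q (E \<union> F) \<beta>"
      unfolding interval_property_def
    proof
      fix s assume s: "s \<in> S"
      then have "nbh (E \<union> F) s = inv_into Q \<beta> ` {1..J (\<alpha> s)}"
        using nbh prefix_image[OF \<beta> JQ'] by simp
      then show "\<exists>j\<in>{0..card Q}. nbh (E \<union> F) s = inv_into Q \<beta> ` {1..j}"
        using JQ'[OF s] by auto
    qed
  qed
  have "card F \<le> card F'" if F': "cnca_feasible S Q E \<alpha> \<beta> k F'" for F'
  proof -
    obtain \<pi>' where \<pi>': "bij_betw \<pi>' S {1..?N}" and nest: "nested S (E \<union> F') \<pi>'"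
      and near: "near S k \<alpha> \<pi>'" and F'sub: "F' \<subseteq> S \<times> Q - E"
      and ip: "interval_property S Q (E \<union> F') \<beta>"
      using F' by (auto simp: cnca_feasible_def ordering_def)
    define \<rho> where "\<rho> = inv_into S \<pi>'"
    define d where "d s = card (nbh (E \<union> F') s)" for s
    have \<rho>: "bij_betw \<rho> {1..?N} S" unfolding \<rho>_def using \<pi>' by (rule bij_betw_inv_into)
    have \<rho>_in: "\<rho> p \<in> S" if "p \<in> {1..?N}" for p using \<rho> that bij_betwE by blast
    have \<pi>'\<rho>: "\<pi>' (\<rho> p) = p" if "p \<in> {1..?N}" for p
      using \<pi>' that by (simp add: \<rho>_def bij_betw_inv_into_right)
    have h: "bij_betw (\<alpha> \<circ> \<rho>) {1..?N} {1..?N}" using \<rho> \<alpha> by (rule bij_betw_trans)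
    have hnear: "(\<alpha> \<circ> \<rho>) r \<le> r + k \<and> r \<le> (\<alpha> \<circ> \<rho>) r + k" if r: "r \<in> {1..?N}" for r
    proof -
      have "int (\<pi>' (\<rho> r)) \<in> {int (\<alpha> (\<rho> r)) - int k..int (\<alpha> (\<rho> r)) + int k}"
        using near \<rho>_in[OF r] by (auto simp only: near_def)
      then show ?thesis using \<pi>'\<rho>[OF r] by auto
    qed
    have E': "E \<union> F' \<subseteq> S \<times> Q" using E F'sub by auto
    have finn: "finite (nbh (E \<union> F') s)" for s
      using E' by (intro finite_subset[OF _ fin(2)]) (auto simp: nbh_def)
    \<comment> \<open>For each \<open>r \<le> p\<close>, domination yields a position
      \<open>u \<le> r\<close> of the other ordering whose student is at least as heavy as
      \<open>g r\<close>. Its degree is at least that weight, and nestedness passes the degree on to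
      position \<open>p\<close>.\<close>
    have le: "J (g p) \<le> d (\<rho> p)" if p: "p \<in> {1..?N}" for p
    proof -
      have "w (g r) \<le> d (\<rho> p)" if r: "r \<in> {1..p}" for r
      proof -
        have "r \<in> {1..?N}" using r p by simp
        then obtain u where u: "u \<in> {1..r}" "w (g r) \<le> w ((\<alpha> \<circ> \<rho>) u)"
          using greedy_dominates[OF g h hnear] by blast
        then have uN: "u \<in> {1..?N}" "u \<le> p" using r p by auto
        have "w ((\<alpha> \<circ> \<rho>) u) \<le> d (\<rho> u)"
          using feasible_degree_ge[OF inst w ip \<rho>_in[OF uN(1)]] by (simp add: d_def)
        also have "nbh (E \<union> F') (\<rho> u) \<subseteq> nbh (E \<union> F') (\<rho> p)"
          using nest \<rho>_in[OF uN(1)] \<rho>_in[OF p] \<pi>'\<rho>[OF uN(1)] \<pi>'\<rho>[OF p] uN(2)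
          unfolding nested_def by metis
        then have "d (\<rho> u) \<le> d (\<rho> p)" unfolding d_def by (intro card_mono finn)
        finally show ?thesis using u(2) by simp
      qed
      then show ?thesis using J[OF p] by (auto simp: top_of_def)
    qed
    \<comment> \<open>Total degrees are regrouped by position in each ordering. Since
      \<open>E\<close> is disjoint from \<open>F\<close> and from \<open>F'\<close>, comparing the
      totals compares the additions.\<close>
    have "card (E \<union> F) = (\<Sum>s\<in>S. card (nbh (E \<union> F) s))"
      using E by (intro card_edges[OF fin]) (auto simp: F)
    also have "\<dots> = (\<Sum>s\<in>S. J (g (\<pi> s)))"
      using nbh card_prefix[OF \<beta> JQ'] g\<pi> by (intro sum.cong) auto
    also have "\<dots> = (\<Sum>p\<in>{1..?N}. J (g p))"
      using sum.reindex_bij_betw[OF \<pi>, of "\<lambda>p. J (g p)"] .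
    also have "\<dots> \<le> (\<Sum>p\<in>{1..?N}. d (\<rho> p))" using le by (rule sum_mono)
    also have "\<dots> = (\<Sum>s\<in>S. d s)" using sum.reindex_bij_betw[OF \<rho>, of d] .
    also have "\<dots> = card (E \<union> F')" using card_edges[OF fin E'] by (simp add: d_def)
    finally have "card (E \<union> F) \<le> card (E \<union> F')" .
    moreover have "finite E" "finite F" "finite F'"
      using fin E F'sub by (auto intro: finite_subset[of _ "S \<times> Q"] simp: F)
    moreover have "E \<inter> F = {}" "E \<inter> F' = {}" using F'sub by (auto simp: F)
    ultimately show ?thesis by (simp add: card_Un_disjoint)
  qed
  then show ?thesis using feas by (simp add: cnca_optimal_def)
qed

subsection \<open>Input and output\<close>

text \<open>Row-major addressing. The index bound is part of the claim because the input array reads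
  0 outside the encoded list.\<close>

lemma nth_concat_uniform:
  assumes "\<forall>xs\<in>set xss. length xs = M" "i < length xss" "j < M"
  shows "i * M + j < length (concat xss) \<and> concat xss ! (i * M + j) = xss ! i ! j"
  using assms
proof (induction xss arbitrary: i)
  case (Cons xs xss)
  show ?case
  proof (cases i)
    case 0
    then show ?thesis using Cons.prems by (simp add: nth_append)
  next
    case (Suc i')
    then show ?thesis using Cons.IH[of i'] Cons.prems by (simp add: nth_append)
  qed
qed simp

lemma input_encode:
  fixes ss :: "'s list" and qs :: "'q list"
  assumes "A = arr (input_state (encode ss qs E \<alpha> \<beta> k)) ''in''"
  defines "N \<equiv> length ss" and "M \<equiv> length qs"
  shows "A 0 = N" "A 1 = M" "A 2 = k"
    and "i < N \<Longrightarrow> A (3 + i) = \<alpha> (ss ! i)"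
    and "j < M \<Longrightarrow> A (3 + N + j) = \<beta> (qs ! j)"
    and "i < N \<Longrightarrow> j < M \<Longrightarrow>
      A (3 + N + M + i * M + j) = (if (ss ! i, qs ! j) \<in> E then 1 else 0)"
proof -
  let ?xs = "encode ss qs E \<alpha> \<beta> k"
  let ?rows = "map (\<lambda>s. map (\<lambda>q. if (s, q) \<in> E then 1 else 0 :: nat) qs) ss"
  have A: "A i = (if i < length ?xs then ?xs ! i else 0)" for i
    by (simp add: assms input_state_def)
  \<comment> \<open>Access to a block \<open>vs\<close> behind a prefix \<open>us\<close>; header,
    both tables and the matrix are the four instances.\<close>
  have at: "A (length us + l) = vs ! l" if "?xs = us @ vs @ zs" "l < length vs" for us vs zs l
    using that by (simp add: A nth_append)
  show "A 0 = N" "A 1 = M" "A 2 = k"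
    using at[of "[]" "[N, M, k]"] by (simp_all add: encode_def N_def M_def numeral_eq_Suc A)
  show "A (3 + i) = \<alpha> (ss ! i)" if "i < N"
    using at[of "[N, M, k]" "map \<alpha> ss" _ i] that by (simp add: encode_def N_def M_def numeral_3_eq_3)
  show "A (3 + N + j) = \<beta> (qs ! j)" if "j < M"
    using at[of "[N, M, k] @ map \<alpha> ss" "map \<beta> qs" _ j] that by (simp add: encode_def N_def M_def numeral_3_eq_3)
  show "A (3 + N + M + i * M + j) = (if (ss ! i, qs ! j) \<in> E then 1 else 0)" if ij: "i < N" "j < M"
  proof -
    have "i * M + j < length (concat ?rows) \<and> concat ?rows ! (i * M + j) = ?rows ! i ! j"
      using ij by (intro nth_concat_uniform) (auto simp: N_def M_def)
    then show ?thesis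
      using at[of "[N, M, k] @ map \<alpha> ss @ map \<beta> qs" "concat ?rows" "[]" "i * M + j"] ij
      by (simp add: encode_def N_def M_def add.assoc numeral_3_eq_3)
  qed
qed

section \<open>Correctness and time bound on encoded instances\<close>

theorem theorem2:
  "\<exists>(P :: com) (C :: nat).
     \<forall>(S :: nat set) (Q :: nat set) (E :: (nat \<times> nat) set) (\<alpha> :: nat \<Rightarrow> nat) (\<beta> :: nat \<Rightarrow> nat)
       (k :: nat) (ss :: nat list) (qs :: nat list) (n :: nat).
       cnca_instance S Q E \<alpha> \<beta> k \<and>
       distinct ss \<and> set ss = S \<and> distinct qs \<and> set qs = Q \<and>
       n = card S + card Q \<longrightarrow>
       (\<exists>t \<tau> F.
          exec P (input_state (encode ss qs E \<alpha> \<beta> k)) t \<tau> \<and>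
          outputs_edges \<tau> ss qs F \<and>
          cnca_optimal S Q E \<alpha> \<beta> k F \<and>
          (n \<ge> 1 \<longrightarrow> t \<le> C * (n ^ 3 * k ^ (2 * k + 2))))"
proof (rule exI[of _ cnca_prog], rule exI[of _ 1000], intro allI impI, elim conjE)
  fix S Q :: "nat set" and E :: "(nat \<times> nat) set" and \<alpha> \<beta> :: "nat \<Rightarrow> nat"
    and k n :: nat and ss qs :: "nat list"
  assume inst: "cnca_instance S Q E \<alpha> \<beta> k" and ss: "distinct ss" "set ss = S"
    and qs: "distinct qs" "set qs = Q" and n: "n = card S + card Q"
  define A where "A = arr (input_state (encode ss qs E \<alpha> \<beta> k)) ''in''"
  define N M where "N = length ss" and "M = length qs"
  have card: "card S = N" "card Q = M"
    using ss qs distinct_card by (auto simp: N_def M_def)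
  note A = input_encode[OF A_def, folded N_def M_def]
  obtain t \<tau> w g J ps where
    ex: "exec cnca_prog (input_state (encode ss qs E \<alpha> \<beta> k)) t \<tau>"
    and t: "t \<le> 250 * (N * N + N * M + N) + 60"
    and w: "\<forall>x. top_of (wset A N M N 0 x) (w x)" and g: "greedy N k w g N"
    and J: "\<forall>q\<in>{1..N}. top_of (w ` g ` {1..q}) (J (g q))"
    and ps: "distinct ps" "set ps = {(i, j). i < N \<and> j < M \<and> selected A J N M i j}"
    and out: "arr \<tau> ''out'' 0 = length ps" "lists_pairs (arr \<tau> ''out'') ps"
    using wp_cnca_prog[OF A_def A(1-3)] unfolding wp_def by blast
  have \<alpha>: "inj_on \<alpha> S" using inst by (auto simp: cnca_instance_def ordering_def bij_betw_def)
  have E: "E \<subseteq> S \<times> Q" using inst by (simp add: cnca_instance_def)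
  have wtop: "top_of (\<beta> ` nbh E s) (w (\<alpha> s))" if s: "s \<in> S" for s
  proof -
    \<comment> \<open>Injectivity of \<alpha> ensures that only the row of \<open>s\<close>
      contributes under the label \<open>\<alpha> s\<close>.\<close>
    have "wset A N M N 0 (\<alpha> s) = \<beta> ` nbh E s"
    proof (intro equalityI subsetI)
      fix b assume "b \<in> wset A N M N 0 (\<alpha> s)"
      then obtain i j where ij: "i < N" "j < M" "A (3 + i) = \<alpha> s"
        "A (3 + N + M + i * M + j) = 1" "b = A (3 + N + j)"
        by (auto simp: wset_def)
      then have "ss ! i = s"
        using A(4)[OF ij(1)] \<alpha> s ss(2) by (auto simp: N_def inj_on_def)
      moreover have "(ss ! i, qs ! j) \<in> E" using A(6)[OF ij(1,2)] ij(4) by (metis zero_neq_one)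
      ultimately show "b \<in> \<beta> ` nbh E s" using A(5)[OF ij(2)] ij(5) unfolding nbh_def by blast
    next
      fix b assume "b \<in> \<beta> ` nbh E s"
      then obtain q where q: "(s, q) \<in> E" "b = \<beta> q" by (auto simp: nbh_def)
      then have "s \<in> set ss" "q \<in> set qs" using E ss qs by auto
      then obtain i j where ij: "i < N" "j < M" "ss ! i = s" "qs ! j = q"
        by (auto simp: in_set_conv_nth N_def M_def)
      then have "A (3 + i) = \<alpha> s" "A (3 + N + M + i * M + j) = 1" "b = A (3 + N + j)"
        using A(4)[OF ij(1)] A(5)[OF ij(2)] A(6)[OF ij(1,2)] q by auto
      then show "b \<in> wset A N M N 0 (\<alpha> s)" using ij unfolding wset_def by blast
    qed
    then show ?thesis using w by metis
  qed
  define F where "F = {(s, q). s \<in> S \<and> q \<in> Q \<and> (s, q) \<notin> E \<and> \<beta> q \<le> J (\<alpha> s)}"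
  have opt: "cnca_optimal S Q E \<alpha> \<beta> k F"
    using g J wtop by (intro greedy_optimal[OF inst _ _ _ F_def, of w g]) (auto simp: card)
  have sel: "selected A J N M i j \<longleftrightarrow> (ss ! i, qs ! j) \<notin> E \<and> \<beta> (qs ! j) \<le> J (\<alpha> (ss ! i))"
    if "i < N" "j < M" for i j
    using A(4)[OF that(1)] A(5)[OF that(2)] A(6)[OF that] by (simp add: selected_def)
  have "F = (\<lambda>(i, j). (ss ! i, qs ! j)) ` set ps"
  proof (intro equalityI subsetI)
    fix x assume "x \<in> F"
    then obtain s q where x: "x = (s, q)" "s \<in> set ss" "q \<in> set qs" "(s, q) \<notin> E" "\<beta> q \<le> J (\<alpha> s)"
      using ss qs by (auto simp: F_def)
    then obtain i j where ij: "i < N" "j < M" "ss ! i = s" "qs ! j = q"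
      by (auto simp: in_set_conv_nth N_def M_def)
    then have "(i, j) \<in> set ps" using x sel[OF ij(1,2)] by (simp add: ps)
    then show "x \<in> (\<lambda>(i, j). (ss ! i, qs ! j)) ` set ps" using x ij by force
  next
    fix x assume "x \<in> (\<lambda>(i, j). (ss ! i, qs ! j)) ` set ps"
    then obtain i j where ij: "i < N" "j < M" "selected A J N M i j" "x = (ss ! i, qs ! j)"
      by (auto simp: ps)
    then have "ss ! i \<in> S" "qs ! j \<in> Q" using ss qs by (auto simp: N_def M_def)
    then show "x \<in> F" using sel[OF ij(1,2)] ij by (simp add: F_def)
  qed
  then have "outputs_edges \<tau> ss qs F"
    unfolding outputs_edges_def using ps out
    by (intro exI[of _ ps]) (auto simp: N_def M_def lists_pairs_def)
  moreover have "t \<le> 1000 * (n ^ 3 * k ^ (2 * k + 2))" if "n \<ge> 1"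
  proof -
    have nNM: "n = N + M" using n card by simp
    have NM: "N * N + N * M = N * n" by (simp add: nNM algebra_simps)
    have Nn: "N \<le> n" using nNM by simp
    then have "N * n + N \<le> n * n + n * n"
      by (intro add_mono mult_le_mono1 order_trans[OF Nn le_square])
    moreover have "1 \<le> n * n" using that by simp
    moreover have "t \<le> 250 * (N * n + N) + 60" using t by (simp add: NM)
    \<comment> \<open>Used with \<open>a = N * n + N\<close> and \<open>b = n * n\<close>: the bound
      is then at most \<open>500 * b + 60 * b\<close>, comfortably below
      \<open>1000 * b\<close>.\<close>
    moreover have "t \<le> 1000 * b" if "a \<le> b + b" "1 \<le> b" "t \<le> 250 * a + 60" for a b
      using that by linarith
    ultimately have "t \<le> 1000 * (n * n)" by blast
    also have "n * n \<le> n ^ 3" using that by (simp add: power3_eq_cube)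
    \<comment> \<open>Since \<open>k\<close> is positive, the power of \<open>k\<close> is at least
      1, so the quadratic bound implies the stated one.\<close>
    also have "n ^ 3 \<le> n ^ 3 * k ^ (2 * k + 2)"
      using inst by (simp add: cnca_instance_def)
    finally show ?thesis by simp
  qed
  ultimately show "\<exists>t \<tau> F. exec cnca_prog (input_state (encode ss qs E \<alpha> \<beta> k)) t \<tau> \<and>
      outputs_edges \<tau> ss qs F \<and> cnca_optimal S Q E \<alpha> \<beta> k F \<and>
      (n \<ge> 1 \<longrightarrow> t \<le> 1000 * (n ^ 3 * k ^ (2 * k + 2)))"
    using ex opt by blast
qed

end
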